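(* For any integers $k\ge 3$ and $n\ge \lfloor 111k/20\rfloor$, $$\nu_k(K_n)\ \ge\ \frac{8000\,(4107k^2-5416k+1309)}{37\,(111k-17)(111k-77)(37k-19)(3k-1)}\binom{n}{4},$$ and the coefficient of $\binom{n}{4}$ on the right-hand side satisfies $$\frac{8000\,(4107k^2-5416k+1309)}{37\,(111k-17)(111k-77)(37k-19)(3k-1)}=\frac{8000}{12321}\cdot\frac{1}{k^2}+\Theta\!\left(\frac{1}{k^3}\right)$$ (as $k\to\infty$).
   Context: A $k$-page book consists of $k$ halfplanes (pages) with a common boundary line (the spine). A $k$-page book drawing of a graph $G$ is a drawing of $G$ in a $k$-page book in which all vertices lie on the spine and edges do not cross the spine (each edge lies in one page). The $k$-page book crossing number $\nu_k(G)$ is the minimum number of edge-crossings over all $k$-page book drawings of $G$. Equivalently (convex model), $\nu_k(K_n)$ is the minimum, over all colorings of the edges of the complete geometric graph on the $n$ vertices of a convex polygon with $k$ colors, of the number of monochromatic crossings, i.e. pairs of edges of the same color that cross in their interiors. $K_n$ is the complete graph on $n$ vertices. *)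

theory Defs
  imports "HOL-Analysis.Analysis" "HOL-Library.Landau_Symbols"
begin

text \<open>
  The book is realised inside \<open>\<real> \<times> \<complex>\<close>, a copy of 3-space: the spine is the line
  \<open>\<real> \<times> {0}\<close>, and page \<open>i < k\<close> is the closed halfplane spanned by the spine and the unit
  vector at angle \<open>2 * pi * i / k\<close> perpendicular to it.
\<close>

definition book_spine :: "(real \<times> complex) set" where
  "book_spine = UNIV \<times> {0}"

definition book_page :: "nat \<Rightarrow> nat \<Rightarrow> (real \<times> complex) set" where
  "book_page k i = {(x, of_real r * cis (2 * pi * real i / real k)) | x r. r \<ge> 0}"

text \<open>
  A graph is given by its vertex set \<open>V\<close> and its set \<open>E\<close> of two-element subsets of \<open>V\<close>.
  In a drawing, \<open>pos v\<close> is the point representing the vertex \<open>v\<close>, and \<open>\<gamma> e\<close> is the simple arc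
  representing the edge \<open>e\<close>. Edges pass through no vertex other than their own endpoints,
  and two distinct edges meet in finitely many points.
\<close>

definition book_drawing ::
  "nat \<Rightarrow> 'a set \<Rightarrow> 'a set set \<Rightarrow> ('a \<Rightarrow> real \<times> complex) \<Rightarrow> ('a set \<Rightarrow> real \<Rightarrow> real \<times> complex) \<Rightarrow> bool"
where
  "book_drawing k V E pos \<gamma> \<longleftrightarrow>
     inj_on pos V \<and> pos ` V \<subseteq> book_spine \<and>
     (\<forall>e\<in>E. arc (\<gamma> e) \<and>
            {pathstart (\<gamma> e), pathfinish (\<gamma> e)} = pos ` e \<and>
            path_image (\<gamma> e) \<inter> pos ` V = pos ` e \<and>
            (\<exists>i<k. path_image (\<gamma> e) \<subseteq> book_page k i)) \<and>
     (\<forall>e\<in>E. \<forall>f\<in>E. e \<noteq> f \<longrightarrow> finite (path_image (\<gamma> e) \<inter> path_image (\<gamma> f)))"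

text \<open>
  A crossing is an unordered pair of distinct edges together with a common interior point, so
  two edges meeting several times contribute several crossings, and a point shared by the
  interiors of several edges is counted once for each pair of them.
\<close>

definition edge_crossings ::
  "'a set \<Rightarrow> 'a set set \<Rightarrow> ('a \<Rightarrow> real \<times> complex) \<Rightarrow> ('a set \<Rightarrow> real \<Rightarrow> real \<times> complex) \<Rightarrow>
     ('a set set \<times> (real \<times> complex)) set"
where
  "edge_crossings V E pos \<gamma> =
     {({e, f}, p) | e f p. e \<in> E \<and> f \<in> E \<and> e \<noteq> f \<and>
        p \<in> path_image (\<gamma> e) \<inter> path_image (\<gamma> f) - pos ` V}"

definition book_crossing_number :: "nat \<Rightarrow> 'a set \<Rightarrow> 'a set set \<Rightarrow> nat" where
  "book_crossing_number k V E =
     (LEAST c. \<exists>pos \<gamma>. book_drawing k V E pos \<gamma> \<and> c = card (edge_crossings V E pos \<gamma>))"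

definition complete_edges :: "nat \<Rightarrow> nat set set" where
  "complete_edges n = {e. e \<subseteq> {..<n} \<and> card e = 2}"

definition book_crossing_number_complete :: "nat \<Rightarrow> nat \<Rightarrow> nat" where
  "book_crossing_number_complete k n = book_crossing_number k {..<n} (complete_edges n)"

text \<open>
  The minimum is attained: the complete graph can be drawn in a single page, the edge
  \<open>{a, b}\<close> being the graph of \<open>(x - a) * (b - x)\<close> over \<open>[a, b]\<close>.
\<close>

definition parabola_arc :: "real \<Rightarrow> real \<Rightarrow> real \<Rightarrow> real \<times> complex" where
  "parabola_arc a b t =
     (let x = a + t * (b - a) in (x, of_real ((x - a) * (b - x))))"

lemma arc_parabola_arc:
  assumes "a < b"
  shows "arc (parabola_arc a b)"
  unfolding arc_def path_def parabola_arc_def Let_def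
  using assms by (auto intro!: continuous_intros inj_onI)

lemma path_image_parabola_arc:
  assumes "a < b"
  shows "path_image (parabola_arc a b) = (\<lambda>x. (x, of_real ((x - a) * (b - x)))) ` {a..b}"
proof -
  have "{a..b} = (\<lambda>t. a + t * (b - a)) ` {0..1}"
  proof (intro equalityI subsetI)
    fix x assume "x \<in> {a..b}"
    then show "x \<in> (\<lambda>t. a + t * (b - a)) ` {0..1}"
      using assms by (intro image_eqI[of _ _ "(x - a) / (b - a)"]) (auto simp: field_simps)
  next
    fix x assume "x \<in> (\<lambda>t. a + t * (b - a)) ` {0..1}"
    then obtain t where t: "0 \<le> t" "t \<le> 1" "x = a + t * (b - a)" by auto
    have "t * (b - a) \<le> 1 * (b - a)" using t assms by (intro mult_right_mono) auto
    moreover have "0 \<le> t * (b - a)" using t assms by simp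
    ultimately show "x \<in> {a..b}" unfolding t(3) by simp
  qed
  then show ?thesis
    unfolding path_image_def parabola_arc_def Let_def by (simp only: image_image)
qed

lemma finite_parabola_arc_Int:
  assumes "a < b" "c < d" "(a, b) \<noteq> (c, d)"
  shows "finite (path_image (parabola_arc a b) \<inter> path_image (parabola_arc c d))"
proof -
  define x0 where "x0 = (a * b - c * d) / (a + b - c - d)"
  have "p = (x0, of_real ((x0 - a) * (b - x0)))"
    if p: "p \<in> path_image (parabola_arc a b) \<inter> path_image (parabola_arc c d)" for p
  proof -
    obtain x where x: "p = (x, of_real ((x - a) * (b - x)))"
      using p unfolding path_image_parabola_arc[OF assms(1)] by blast
    obtain y where y: "p = (y, of_real ((y - c) * (d - y)))"
      using p unfolding path_image_parabola_arc[OF assms(2)] by blast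
    have "(x - a) * (b - x) = (x - c) * (d - x)"
      using x y by (metis prod.inject of_real_eq_iff)
    then have eq: "(a + b - c - d) * x = a * b - c * d" by (simp add: algebra_simps)
    have "a + b - c - d \<noteq> 0"
    proof
      assume s: "a + b - c - d = 0"
      have "(a - c) * (a - d) = a * a - a * (c + d) + c * d" by (simp add: algebra_simps)
      also have "\<dots> = a * a - a * (a + b) + a * b" using s eq by (simp add: algebra_simps)
      also have "\<dots> = 0" by (simp add: algebra_simps)
      finally have "a = c \<or> a = d" by simp
      then show False using s assms by auto
    qed
    then have "x = x0" using eq by (simp add: x0_def field_simps)
    then show ?thesis using x by simp
  qed
  then have "path_image (parabola_arc a b) \<inter> path_image (parabola_arc c d)
      \<subseteq> {(x0, of_real ((x0 - a) * (b - x0)))}" by blast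
  then show ?thesis by (rule finite_subset) simp
qed

lemma complete_edgesE:
  assumes "e \<in> complete_edges n"
  obtains a b where "e = {a, b}" "a < b" "b < n"
proof -
  obtain a b where ab: "e = {a, b}" "a \<noteq> b" "a < n" "b < n"
    using assms by (auto simp: complete_edges_def card_2_iff)
  show ?thesis
  proof (cases "a < b")
    case True
    then show ?thesis using ab that by blast
  next
    case False
    then show ?thesis using ab that[of b a] by (auto simp: insert_commute)
  qed
qed

lemma book_drawing_complete_exists:
  assumes "k > 0"
  shows "\<exists>pos \<gamma>. book_drawing k {..<n} (complete_edges n) pos \<gamma>"
proof -
  define pos :: "nat \<Rightarrow> real \<times> complex" where "pos v = (real v, 0)" for v
  define \<gamma> where "\<gamma> e = parabola_arc (real (Min e)) (real (Max e))" for e :: "nat set"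
  have \<gamma>: "\<gamma> {a, b} = parabola_arc (real a) (real b)" if "a < b" for a b
    using that by (simp add: \<gamma>_def)
  have "arc (\<gamma> e) \<and> {pathstart (\<gamma> e), pathfinish (\<gamma> e)} = pos ` e \<and>
        path_image (\<gamma> e) \<inter> pos ` {..<n} = pos ` e \<and>
        (\<exists>i<k. path_image (\<gamma> e) \<subseteq> book_page k i)"
    if "e \<in> complete_edges n" for e
  proof -
    obtain a b where e: "e = {a, b}" "a < b" "b < n" using complete_edgesE \<open>e \<in> _\<close> by blast
    have im: "path_image (\<gamma> e) =
        (\<lambda>x. (x, of_real ((x - real a) * (real b - x)))) ` {real a..real b}"
      using e by (simp add: \<gamma> path_image_parabola_arc)
    have "path_image (\<gamma> e) \<subseteq> book_page k 0"
      unfolding im book_page_def by (auto simp del: of_real_mult of_real_diff)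
    moreover have "path_image (\<gamma> e) \<inter> pos ` {..<n} = pos ` e"
      unfolding im using e by (auto simp: pos_def image_iff)
    moreover have "{pathstart (\<gamma> e), pathfinish (\<gamma> e)} = pos ` e"
      using e by (simp add: \<gamma> pathstart_def pathfinish_def parabola_arc_def pos_def)
    ultimately show ?thesis
      using e assms arc_parabola_arc[of a b] by (auto simp: \<gamma>)
  qed
  moreover have "finite (path_image (\<gamma> e) \<inter> path_image (\<gamma> f))"
    if ef: "e \<in> complete_edges n" "f \<in> complete_edges n" "e \<noteq> f" for e f
  proof -
    obtain a b where e: "e = {a, b}" "a < b" using ef(1) by (rule complete_edgesE)
    obtain c d where f: "f = {c, d}" "c < d" using ef(2) by (rule complete_edgesE)
    show ?thesis
      using e f ef(3) finite_parabola_arc_Int[of a b c d] by (auto simp: \<gamma>)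
  qed
  ultimately have "book_drawing k {..<n} (complete_edges n) pos \<gamma>"
    unfolding book_drawing_def by (auto simp: inj_on_def pos_def book_spine_def)
  then show ?thesis by blast
qed

lemma book_crossing_number_complete_attained:
  assumes "k > 0"
  shows "\<exists>pos \<gamma>. book_drawing k {..<n} (complete_edges n) pos \<gamma> \<and>
           book_crossing_number_complete k n = card (edge_crossings {..<n} (complete_edges n) pos \<gamma>)"
proof -
  let ?P = "\<lambda>c. \<exists>pos \<gamma>. book_drawing k {..<n} (complete_edges n) pos \<gamma> \<and>
                  c = card (edge_crossings {..<n} (complete_edges n) pos \<gamma>)"
  have "\<exists>c. ?P c" using book_drawing_complete_exists[OF assms, of n] by blast
  then have "?P (LEAST c. ?P c)" by (rule LeastI_ex)
  then show ?thesis
    unfolding book_crossing_number_complete_def book_crossing_number_def .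
qed

lemma finite_edge_crossings:
  assumes "finite E" "book_drawing k V E pos \<gamma>"
  shows "finite (edge_crossings V E pos \<gamma>)"
proof -
  have "edge_crossings V E pos \<gamma> \<subseteq>
      (\<Union>e\<in>E. \<Union>f\<in>E - {e}. {{e, f}} \<times> (path_image (\<gamma> e) \<inter> path_image (\<gamma> f)))"
    unfolding edge_crossings_def by auto
  moreover have "finite \<dots>"
    using assms by (intro finite_UN_I finite_cartesian_product) (auto simp: book_drawing_def)
  ultimately show ?thesis by (rule finite_subset)
qed

end

theory Submission
  imports Defs "HOL-Real_Asymp.Real_Asymp"
begin

text \<open>
  Draw \<open>K\<^sub>n\<close> convexly and let a page carry the chord set \<open>E\<close>; adding the uncrossed polygon sides to
  every page changes nothing. The heart of the matter is the linear bound
  \<open>20 |E| \<le> 57 (n - 2) + 12 + 4 cr(E)\<close>. Summed over the pages and averaged over the vertex subsets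
  of size \<open>\<lfloor>111 k / 20\<rfloor>\<close> it gives the theorem.

  In a minimal counterexample to the linear bound, choose \<open>E\<close> maximising \<open>20 |E| - 4 cr(E)\<close>, and then
  of least size. Every edge is then crossed at most 4 times and every non-edge at least 5 times.
  Cutting along a chord, or deleting a vertex, shows that a chord is crossed at least twice unless it
  is a side, and that the edges at a vertex on only two diagonals are crossed at most 5 times
  altogether. This determines the edges that cut off at most three vertices. Finally take an edge
  \<open>pq\<close> that cuts off at least four vertices, with no shorter such edge inside: the two vertices next
  to \<open>p\<close> send at least three edges across \<open>pq\<close>, and so do the two next to \<open>q\<close>, but \<open>pq\<close> is crossed
  at most 4 times.
\<close>

section \<open>Chords and crossings\<close>

text \<open>Chords of a convex polygon cross exactly when their ends alternate, so any linearly
  ordered set can serve as the polygon. The weights 20 and 4 have ratio 5, the number of crossings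
  at which dropping an edge costs nothing. The complete graph on six vertices, with 15 edges and 15
  crossings, meets the linear bound with equality. Splitting at an uncrossed chord leaves 8 to
  spare; splitting at a chord with one crossing falls 12 short, and that must be recovered from the
  crossings of the edge dropped. A set of N vertices yields at least (10 N (N - 3) - k (37 N - 102))
  / 4 monochromatic crossings. Relative to \<open>N choose 4\<close> this behaves like (10 N - 37 k)
  / N^3, which is largest at N = 111 k / 20; this is the origin of the subset size and of
  8000/12321. Arbitrary drawings enter only at the end: a drawing induces a colouring by pages, and
  interlaced arcs in one halfplane must meet.\<close>

definition chords :: "'a::linorder set \<Rightarrow> ('a \<times> 'a) set" where
  "chords V = {(a, b). a \<in> V \<and> b \<in> V \<and> a < b}"

text \<open>The relation is oriented: the chord with the smaller left end comes first. Hence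
  \<open>crossings\<close> holds one pair per crossing, while \<open>crossed_by\<close> asks in both
  directions.\<close>

definition crosses :: "'a::linorder \<times> 'a \<Rightarrow> 'a \<times> 'a \<Rightarrow> bool" where
  "crosses e f \<longleftrightarrow> fst e < fst f \<and> fst f < snd e \<and> snd e < snd f"

definition crossings :: "('a::linorder \<times> 'a) set \<Rightarrow> (('a \<times> 'a) \<times> ('a \<times> 'a)) set" where
  "crossings E = {(e, f). e \<in> E \<and> f \<in> E \<and> crosses e f}"

definition crossed_by :: "'a::linorder \<times> 'a \<Rightarrow> ('a \<times> 'a) set \<Rightarrow> ('a \<times> 'a) set" where
  "crossed_by e E = {f \<in> E. crosses e f \<or> crosses f e}"

text \<open>The bound \<open>20 |E| \<le> 57 (|V| - 2) + 12 + 4 cr(E)\<close>, rearranged to avoid subtraction.\<close>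

definition crossing_bound :: "'a::linorder set \<Rightarrow> bool" where
  "crossing_bound V \<longleftrightarrow>
     (\<forall>E \<subseteq> chords V. 20 * card E + 102 \<le> 57 * card V + 4 * card (crossings E))"

lemma not_crosses_self [simp]: "\<not> crosses e e"
  by (simp add: crosses_def)

lemma crosses_asym: "crosses e f \<Longrightarrow> \<not> crosses f e"
  by (auto simp: crosses_def)

lemma chords_mono: "V \<subseteq> W \<Longrightarrow> chords V \<subseteq> chords W"
  by (auto simp: chords_def)

lemma finite_chords: "finite V \<Longrightarrow> finite (chords V)"
  by (rule finite_subset[of _ "V \<times> V"]) (auto simp: chords_def)

lemma crossings_mono: "E \<subseteq> F \<Longrightarrow> crossings E \<subseteq> crossings F"
  by (auto simp: crossings_def)

lemma finite_crossings: "finite E \<Longrightarrow> finite (crossings E)"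
  by (rule finite_subset[of _ "E \<times> E"]) (auto simp: crossings_def)

lemma finite_crossed_by: "finite E \<Longrightarrow> finite (crossed_by e E)"
  by (simp add: crossed_by_def)

lemma card_crossings_insert:
  assumes "finite E" "e \<notin> E"
  shows "card (crossings (insert e E)) = card (crossings E) + card (crossed_by e E)"
proof -
  let ?g = "\<lambda>f. if crosses e f then (e, f) else (f, e)"
  have eq: "crossings (insert e E) = crossings E \<union> ?g ` crossed_by e E"
  proof (intro equalityI subsetI)
    fix x assume x: "x \<in> crossings (insert e E)"
    then obtain f g where fg: "x = (f, g)" "crosses f g" "f \<in> insert e E" "g \<in> insert e E"
      by (auto simp: crossings_def)
    consider "f = e" "g \<in> E" | "g = e" "f \<in> E" | "f \<in> E" "g \<in> E" using fg by auto
    then show "x \<in> crossings E \<union> ?g ` crossed_by e E"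
    proof cases
      case 1
      then show ?thesis using fg by (intro UnI2 image_eqI[of _ _ g]) (auto simp: crossed_by_def)
    next
      case 2
      then show ?thesis using fg crosses_asym[of f e]
        by (intro UnI2 image_eqI[of _ _ f]) (auto simp: crossed_by_def)
    next
      case 3
      then show ?thesis using fg by (auto simp: crossings_def)
    qed
  qed (auto simp: crossings_def crossed_by_def split: if_splits)
  have inj: "inj_on ?g (crossed_by e E)"
    using assms(2) by (auto simp: inj_on_def crossed_by_def split: if_splits)
  have "crossings E \<inter> ?g ` crossed_by e E = {}"
    using assms(2) by (auto simp: crossings_def split: if_splits)
  then have "card (crossings E \<union> ?g ` crossed_by e E)
      = card (crossings E) + card (?g ` crossed_by e E)"
    using assms(1) by (intro card_Un_disjoint finite_crossings finite_imageI finite_crossed_by)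
  then show ?thesis
    unfolding eq using inj by (simp only: card_image)
qed

lemma card_crossings_remove:
  assumes "finite E" "e \<in> E"
  shows "card (crossings E) = card (crossings (E - {e})) + card (crossed_by e E)"
proof -
  have "crossed_by e (E - {e}) = crossed_by e E"
    by (auto simp: crossed_by_def)
  then show ?thesis
    using card_crossings_insert[of "E - {e}" e] assms by (simp add: insert_absorb)
qed

lemma card_crossings_disjoint_Un:
  assumes "finite E" "finite F" "\<And>e f. e \<in> E \<inter> F \<Longrightarrow> f \<in> E \<inter> F \<Longrightarrow> \<not> crosses e f"
  shows "card (crossings E) + card (crossings F) \<le> card (crossings (E \<union> F))"
proof -
  have "crossings E \<inter> crossings F = {}"
    using assms(3) by (auto simp: crossings_def)
  then have "card (crossings E) + card (crossings F) = card (crossings E \<union> crossings F)"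
    using assms by (simp add: card_Un_disjoint finite_crossings)
  also have "\<dots> \<le> card (crossings (E \<union> F))"
    using assms by (intro card_mono finite_crossings) (auto simp: crossings_def)
  finally show ?thesis .
qed

text \<open>Crossings depend only on the order of the vertices. So an induction over initial
  segments of the naturals covers the pieces of a split, which may have gaps, and later the real
  positions on the spine.\<close>

lemma crossing_bound_transfer:
  fixes V :: "'a::linorder set" and W :: "'b::linorder set"
  assumes "crossing_bound W" "finite V" "finite W" "card V = card W"
  shows "crossing_bound V"
  unfolding crossing_bound_def
proof (intro allI impI)
  fix E assume E: "E \<subseteq> chords V"
  obtain r where r: "strict_mono_on V r" "r ` V = W"
  proof -
    define xs where "xs = sorted_list_of_set V"
    define ys where "ys = sorted_list_of_set W"
    have xs: "sorted_wrt (<) xs" "set xs = V" "length xs = card V"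
      and ys: "sorted_wrt (<) ys" "set ys = W" "length ys = card W"
      using assms by (auto simp: xs_def ys_def)
    define r where "r x = ys ! (THE i. i < length xs \<and> xs ! i = x)" for x
    have dx: "distinct xs" by (simp add: xs_def)
    have r: "r (xs ! i) = ys ! i" if "i < length xs" for i
    proof -
      have "(THE j. j < length xs \<and> xs ! j = xs ! i) = i"
        using that dx by (intro the_equality) (auto simp: nth_eq_iff_index_eq)
      then show ?thesis by (simp add: r_def)
    qed
    have "strict_mono_on V r"
    proof (rule strict_mono_onI)
      fix x y assume xy: "x \<in> V" "y \<in> V" "x < y"
      then obtain i j where ij: "i < length xs" "x = xs ! i" "j < length xs" "y = xs ! j"
        using xs(2) by (metis in_set_conv_nth)
      have "i < j"
      proof (rule ccontr)
        assume "\<not> i < j"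
        then have "y \<le> x"
          using sorted_wrt_nth_less[OF xs(1), of j i] ij by (cases "i = j") auto
        then show False using xy by simp
      qed
      then show "r x < r y"
        using sorted_wrt_nth_less[OF ys(1), of i j] ij r xs(3) ys(3) assms(4) by simp
    qed
    moreover have "r ` V = W"
    proof -
      have "r ` V = r ` (\<lambda>i. xs ! i) ` {..<length xs}"
        using xs(2) by (metis list.set_map map_nth set_upt atLeast0LessThan)
      also have "\<dots> = (\<lambda>i. ys ! i) ` {..<length ys}"
        unfolding image_image using r xs(3) ys(3) assms(4) by (intro image_cong) auto
      also have "\<dots> = W" 
        using ys(2) by (metis list.set_map map_nth set_upt atLeast0LessThan)
      finally show ?thesis .
    qed
    ultimately show ?thesis by (rule that)
  qed
  let ?h = "map_prod r r"
  have less: "r x < r y \<longleftrightarrow> x < y" if "x \<in> V" "y \<in> V" for x y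
    using that r(1) by (metis linorder_neqE not_less_iff_gr_or_eq strict_mono_onD)
  have inj: "inj_on r V" using r(1) by (rule strict_mono_on_imp_inj_on)
  have finE: "finite E" using E assms(2) finite_chords finite_subset by blast
  have injE: "inj_on ?h E"
  proof (rule inj_on_subset)
    show "inj_on ?h (V \<times> V)" using inj by (auto simp: inj_on_def)
    show "E \<subseteq> V \<times> V" using E by (auto simp: chords_def)
  qed
  have sub: "?h ` E \<subseteq> chords W"
    using E r(2) less by (auto simp: chords_def)
  have cross: "crosses (?h e) (?h f) \<longleftrightarrow> crosses e f" if "e \<in> E" "f \<in> E" for e f
  proof -
    have "fst e \<in> V" "snd e \<in> V" "fst f \<in> V" "snd f \<in> V"
      using that E by (auto simp: chords_def)
    then show ?thesis by (simp add: crosses_def less)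
  qed
  have "crossings (?h ` E) \<subseteq> map_prod ?h ?h ` crossings E"
  proof
    fix x assume "x \<in> crossings (?h ` E)"
    then have "fst x \<in> ?h ` E" "snd x \<in> ?h ` E" "crosses (fst x) (snd x)"
      by (simp_all add: crossings_def case_prod_beta)
    moreover obtain e where "e \<in> E" "fst x = ?h e" using calculation(1) by (rule imageE)
    moreover obtain f where "f \<in> E" "snd x = ?h f" using calculation(2) by (rule imageE)
    ultimately have "(e, f) \<in> crossings E" "x = map_prod ?h ?h (e, f)"
      using cross by (simp_all add: crossings_def prod_eq_iff)
    then show "x \<in> map_prod ?h ?h ` crossings E" by (rule rev_image_eqI)
  qed
  then have "card (crossings (?h ` E)) \<le> card (crossings E)"
    using finE by (meson card_image_le card_mono finite_crossings finite_imageI le_trans)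
  moreover have "20 * card (?h ` E) + 102 \<le> 57 * card W + 4 * card (crossings (?h ` E))"
    using assms(1) sub unfolding crossing_bound_def by blast
  ultimately show "20 * card E + 102 \<le> 57 * card V + 4 * card (crossings E)"
    using card_image[OF injE] assms(4) by simp
qed

section \<open>Minimal counterexamples\<close>

text \<open>\<open>smaller\<close> ranges over arbitrary vertex sets because the outer piece of a
  split need not be an initial segment. It stops at three vertices because the bound fails for one
  chord on two: 20 + 102 > 114.\<close>

locale minimal_counterexample =
  fixes n :: nat and E :: "(nat \<times> nat) set"
  assumes n_ge: "n \<ge> 6"
    and E_sub: "E \<subseteq> chords {..<n}"
    and smaller: "\<And>V :: nat set. finite V \<Longrightarrow> 3 \<le> card V \<Longrightarrow> card V < n \<Longrightarrow> crossing_bound V"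
    and exceeds: "57 * n + 4 * card (crossings E) < 20 * card E + 102"
    and edge_le: "\<And>e. e \<in> E \<Longrightarrow> card (crossed_by e E) \<le> 4"
    and nonedge_ge: "\<And>e. e \<in> chords {..<n} \<Longrightarrow> e \<notin> E \<Longrightarrow> 5 \<le> card (crossed_by e E)"
begin

abbreviation cut :: "nat \<Rightarrow> nat \<Rightarrow> nat" where
  "cut p q \<equiv> card (crossed_by (p, q) E)"

lemma finE: "finite E"
  using E_sub finite_chords finite_subset by blast

lemma E_less: "(a, b) \<in> E \<Longrightarrow> a < b \<and> b < n"
  using E_sub by (auto simp: chords_def)

text \<open>Both pieces keep \<open>pq\<close> as a side, hence the 1 in the edge count; they share
  no other edge, so no crossing lies in both. The conditions on \<open>p\<close> and
  \<open>q\<close> leave at least three vertices in each piece.\<close>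

lemma split_at_chord:
  fixes p q
  defines "V1 \<equiv> {p..q}" and "V2 \<equiv> {..p} \<union> {q..<n}"
  defines "E1 \<equiv> E \<inter> chords V1" and "E2 \<equiv> E \<inter> chords V2"
  assumes pq: "p + 2 \<le> q" "q < n" "(p, q) \<noteq> (0, n - 1)" "(p, q) \<in> E"
  shows "card V1 = q - p + 1" "card V2 = p + 1 + n - q"
    "card E + 1 = card E1 + card E2 + cut p q"
    "card (crossings E1) + card (crossings E2) \<le> card (crossings (E - crossed_by (p, q) E))"
    "20 * card E1 + 102 \<le> 57 * card V1 + 4 * card (crossings E1)"
    "20 * card E2 + 102 \<le> 57 * card V2 + 4 * card (crossings E2)"
proof -
  let ?X = "crossed_by (p, q) E"
  show cV1: "card V1 = q - p + 1" using pq by (simp add: V1_def)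
  show cV2: "card V2 = p + 1 + n - q"
    unfolding V2_def using pq by (subst card_Un_disjoint) auto
  have fin: "finite E1" "finite E2" "finite ?X"
    using finE by (auto simp: E1_def E2_def crossed_by_def)
  have Int: "E1 \<inter> E2 = {(p, q)}"
    using pq unfolding E1_def E2_def V1_def V2_def by (auto simp: chords_def)
  have Un: "E1 \<union> E2 = E - ?X"
  proof (intro equalityI subsetI)
    fix e assume "e \<in> E1 \<union> E2"
    then show "e \<in> E - ?X"
      unfolding E1_def E2_def V1_def V2_def crossed_by_def crosses_def chords_def by auto
  next
    fix e assume e: "e \<in> E - ?X"
    obtain a b where ab: "e = (a, b)" by (cases e)
    then show "e \<in> E1 \<union> E2"
      using e E_less[of a b] pq(1)
      unfolding E1_def E2_def V1_def V2_def crossed_by_def crosses_def chords_def by auto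
  qed
  have "card E1 + card E2 = card (E1 \<union> E2) + 1"
    using card_Un_Int[OF fin(1,2)] Int by simp
  also have "card (E1 \<union> E2) = card E - cut p q"
    unfolding Un using fin(3) by (intro card_Diff_subset) (auto simp: crossed_by_def)
  also have "cut p q \<le> card E"
    using finE by (intro card_mono) (auto simp: crossed_by_def)
  then have "card E - cut p q + 1 = card E + 1 - cut p q" by simp
  finally show "card E + 1 = card E1 + card E2 + cut p q"
    using \<open>cut p q \<le> card E\<close> by simp
  show "card (crossings E1) + card (crossings E2) \<le> card (crossings (E - ?X))"
    unfolding Un[symmetric] using fin Int by (intro card_crossings_disjoint_Un) auto
  have "finite V1" "finite V2" by (auto simp: V1_def V2_def)
  moreover have "3 \<le> card V1" "card V1 < n" "3 \<le> card V2" "card V2 < n"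
    unfolding cV1 cV2 using pq by auto
  ultimately have "crossing_bound V1" "crossing_bound V2"
    using smaller by blast+
  then show "20 * card E1 + 102 \<le> 57 * card V1 + 4 * card (crossings E1)"
    "20 * card E2 + 102 \<le> 57 * card V2 + 4 * card (crossings E2)"
    unfolding crossing_bound_def E1_def E2_def by auto
qed

lemma in_E: "p < q \<Longrightarrow> q < n \<Longrightarrow> cut p q \<le> 4 \<Longrightarrow> (p, q) \<in> E"
  using nonedge_ge[of "(p, q)"] by (force simp: chords_def)

text \<open>At an uncrossed chord the bounds of the two pieces add up to 20 |E| + 110 \<le> 57 n + 4
  cr(E), better than the 102 that the counterexample violates.\<close>

lemma cut_pos:
  assumes pq: "p + 2 \<le> q" "q < n" "(p, q) \<noteq> (0, n - 1)"
  shows "1 \<le> cut p q"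
proof (rule ccontr)
  assume "\<not> 1 \<le> cut p q"
  then have 0: "cut p q = 0" by simp
  then have "crossed_by (p, q) E = {}"
    using finE by (simp add: finite_crossed_by)
  then show False
    using split_at_chord[OF pq in_E] pq 0 exceeds by simp
qed

lemma card_triangle:
  assumes "a < b" "b < c"
  shows "card (E \<inter> chords {a, b, c}) \<le> 3"
proof -
  have "E \<inter> chords {a, b, c} \<subseteq> {(a, b), (a, c), (b, c)}"
    using assms by (auto simp: chords_def)
  then have "card (E \<inter> chords {a, b, c}) \<le> card {(a, b), (a, c), (b, c)}"
    by (intro card_mono) auto
  also have "\<dots> \<le> 3" by (simp add: card_insert_if)
  finally show ?thesis .
qed

lemma crossed_byI: "f \<in> E \<Longrightarrow> crosses e f \<or> crosses f e \<Longrightarrow> f \<in> crossed_by e E"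
  by (simp add: crossed_by_def)

lemma cut_nonempty:
  assumes "p + 2 \<le> q" "q < n" "(p, q) \<noteq> (0, n - 1)"
  obtains a b where "(a, b) \<in> E" "crosses (p, q) (a, b) \<or> crosses (a, b) (p, q)"
proof -
  have "crossed_by (p, q) E \<noteq> {}"
    using cut_pos[OF assms] by auto
  then show ?thesis
    using that by (auto simp: crossed_by_def)
qed

text \<open>
  If \<open>pq\<close> is crossed by \<open>f\<close> alone, then splitting at \<open>pq\<close> and dropping \<open>f\<close> is too cheap once \<open>f\<close> has
  three crossings. It has: on either side of \<open>pq\<close>, an endpoint of \<open>f\<close> and an endpoint of \<open>pq\<close> span a
  chord that is not a side, so something crosses it and hence \<open>f\<close>. The exception is a side of \<open>pq\<close>
  with a single vertex, which can be deleted.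
\<close>

lemma cut_ge_2:
  assumes pq: "p + 2 \<le> q" "q < n" "(p, q) \<noteq> (0, n - 1)"
  shows "2 \<le> cut p q"
proof (rule ccontr)
  assume "\<not> 2 \<le> cut p q"
  then have 1: "cut p q = 1" using cut_pos[OF pq] by simp
  have pqE: "(p, q) \<in> E" using 1 pq by (intro in_E) auto
  obtain f where X: "crossed_by (p, q) E = {f}"
    using 1 card_1_singletonE by blast
  obtain a b where f: "f = (a, b)" by (cases f)
  have fE: "(a, b) \<in> E" and fc: "crosses (p, q) (a, b) \<or> crosses (a, b) (p, q)"
    using X f by (auto simp: crossed_by_def)
  have only: "x = a \<and> y = b" if "(x, y) \<in> E" "crosses (p, q) (x, y) \<or> crosses (x, y) (p, q)" for x y
    using crossed_byI[OF that] X f by simp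
  define x where "x = (if crosses (p, q) (a, b) then a else b)"
  define y where "y = (if crosses (p, q) (a, b) then b else a)"
  have x: "p < x" "x < q" "0 < x" "x < n - 1" and y: "y < p \<or> q < y" "y < n"
    and xy: "a = x \<and> b = y \<and> q < y \<or> a = y \<and> b = x \<and> y < p"
    using fc E_less[OF fE] pq by (auto simp: x_def y_def crosses_def)
  note sp = split_at_chord[OF pq pqE]
  let ?V1 = "{p..q}" and ?V2 = "{..p} \<union> {q..<n}"
  have fin: "finite (E - {f})" using finE by simp
  have cr: "card (crossings E) = card (crossings (E - {f})) + card (crossed_by f E)"
    using finE fE f by (intro card_crossings_remove) auto
  \<comment> \<open>If \<open>f\<close> has t crossings, the pieces give 20 |E| + 90 + 4 t \<le> 57
    n + 4 cr(E); at t = 3 this reaches 102.\<close>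
  have "card (crossed_by f E) < 3"
    using sp 1 X cr exceeds pq by simp
  have f_pq: "(p, q) \<in> crossed_by f E"
    using fc pqE f by (auto simp: crossed_by_def)
  have pos: "1 \<le> card (crossed_by f E)"
    using f_pq finE by (simp add: Suc_le_eq card_gt_0_iff finite_crossed_by) auto
  show False
  \<comment> \<open>A triangle uses at most 60 of the 69 that its bound allows. This gains 9, so the
    crossing of \<open>f\<close> with \<open>pq\<close> is already enough.\<close>
  proof (cases "q = p + 2 \<or> n = q - p + 2")
    case True
    then show ?thesis
    proof
      assume q: "q = p + 2"
      have "{p..q} = {p, p + 1, p + 2}" using q by auto
      then have "card (E \<inter> chords {p..q}) \<le> 3" using card_triangle[of p "p + 1" "p + 2"] by simp
      then show False using sp 1 X cr exceeds pq pos q by simp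
    next
      assume nq: "n = q - p + 2"
      have "card (E \<inter> chords ?V2) \<le> 3"
      proof (cases "p = 0")
        case True
        then have "?V2 = {p, q, q + 1}" using nq pq by auto
        then show ?thesis using card_triangle[of p q "q + 1"] pq by simp
      next
        case False
        then have "p = 1" "q = n - 1" using nq pq by auto
        then have "?V2 = {0, p, q}" using pq by auto
        then show ?thesis using card_triangle[of 0 p q] pq \<open>p = 1\<close> by simp
      qed
      then show False using sp 1 X cr exceeds pq pos nq by simp
    qed
  next
    case big: False
    \<comment> \<open>The chord from the inner end \<open>x\<close> of \<open>f\<close> to
      \<open>p\<close>, or to \<open>q\<close> if \<open>px\<close> is a side, is crossed by some
      edge. That edge is not \<open>f\<close>, which ends at \<open>x\<close>, so it does not cross
      \<open>pq\<close>; it stays on this side and crosses \<open>f\<close>.\<close>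
    obtain g where g: "g \<in> crossed_by f E" "p \<le> fst g" "snd g \<le> q" "g \<noteq> (p, q)"
    proof (cases "x = p + 1")
      case False
      then obtain c d where cd: "(c, d) \<in> E" "crosses (p, x) (c, d) \<or> crosses (c, d) (p, x)"
        using cut_nonempty[of p x] x pq by auto
      have "p < c \<and> c < x \<and> x < d \<and> d \<le> q"
        using cd(2) only[OF cd(1)] x xy by (auto simp: crosses_def not_less[symmetric])
      then show thesis
        using cd(1) x xy f by (intro that[of "(c, d)"]) (auto simp: crossed_by_def crosses_def)
    next
      case xp: True
      then obtain c d where cd: "(c, d) \<in> E" "crosses (x, q) (c, d) \<or> crosses (c, d) (x, q)"
        using cut_nonempty[of x q] x pq big by auto
      have "p \<le> c \<and> c < x \<and> x < d \<and> d < q"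
        using cd(2) only[OF cd(1)] x xy by (auto simp: crosses_def not_less[symmetric])
      then show thesis
        using cd(1) x xy f by (intro that[of "(c, d)"]) (auto simp: crossed_by_def crosses_def)
    qed
    \<comment> \<open>The same with the outer end \<open>y\<close>. If \<open>y\<close> is next to
      an end of \<open>pq\<close>, the chord from \<open>y\<close> to the other end is used; it is
      not \<open>(0, n - 1)\<close> because more than one vertex lies beyond
      \<open>pq\<close>.\<close>
    obtain h where h: "h \<in> crossed_by f E" "fst h < p \<or> q < snd h"
    proof (cases "a = x")
      case True
      then have y: "a = x" "b = y" "q < y" "y < n" using xy y x by auto
      show thesis
      proof (cases "y = q + 1")
        case False
        then obtain c d where cd: "(c, d) \<in> E" "crosses (q, y) (c, d) \<or> crosses (c, d) (q, y)"
          using cut_nonempty[of q y] x pq y by auto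
        have "c \<le> p \<and> q < d \<and> d < y \<or> q < c \<and> c < y \<and> y < d"
          using cd(2) only[OF cd(1)] x y by (auto simp: crosses_def not_less[symmetric])
        then show thesis
          using cd(1) x y f by (intro that[of "(c, d)"]) (auto simp: crossed_by_def crosses_def)
      next
        case yq: True
        then have "(p, y) \<noteq> (0, n - 1)" using big pq by auto
        then obtain c d where cd: "(c, d) \<in> E" "crosses (p, y) (c, d) \<or> crosses (c, d) (p, y)"
          using cut_nonempty[of p y] x pq y yq by auto
        have no: "\<not> crosses (p, q) (c, d) \<and> \<not> crosses (c, d) (p, q)"
          using only[OF cd(1)] cd(2) x y yq by (auto simp: crosses_def)
        have "c = q \<and> y < d \<or> c < p \<and> d = q"
          using no cd(2) pq x y yq unfolding crosses_def fst_conv snd_conv by linarith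
        then show thesis
          using cd(1) x y f pq by (intro that[of "(c, d)"]) (auto simp: crossed_by_def crosses_def)
      qed
    next
      case False
      then have y: "a = y" "b = x" "y < p" using xy by auto
      show thesis
      proof (cases "p = y + 1")
        case False
        then obtain c d where cd: "(c, d) \<in> E" "crosses (y, p) (c, d) \<or> crosses (c, d) (y, p)"
          using cut_nonempty[of y p] x pq y by auto
        have "y < c \<and> c < p \<and> q \<le> d \<or> c < y \<and> y < d \<and> d < p"
          using cd(2) only[OF cd(1)] x y by (auto simp: crosses_def not_less[symmetric])
        then show thesis
          using cd(1) x y f by (intro that[of "(c, d)"]) (auto simp: crossed_by_def crosses_def)
      next
        case yp: True
        then have "(y, q) \<noteq> (0, n - 1)" using big pq by auto
        then obtain c d where cd: "(c, d) \<in> E" "crosses (y, q) (c, d) \<or> crosses (c, d) (y, q)"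
          using cut_nonempty[of y q] x pq y yp by auto
        have no: "\<not> crosses (p, q) (c, d) \<and> \<not> crosses (c, d) (p, q)"
          using only[OF cd(1)] cd(2) x y yp by (auto simp: crosses_def)
        have "c = p \<and> q < d \<or> c < y \<and> d = p"
          using no cd(2) pq x y yp unfolding crosses_def fst_conv snd_conv by linarith
        then show thesis
          using cd(1) x y f pq by (intro that[of "(c, d)"]) (auto simp: crossed_by_def crosses_def)
      qed
    qed
    have "card {(p, q), g, h} \<le> card (crossed_by f E)"
      using f_pq g h finE by (intro card_mono) (auto simp: finite_crossed_by)
    moreover have "distinct [(p, q), g, h]" using g h by auto
    then have "card {(p, q), g, h} = 3" using distinct_card[of "[(p, q), g, h]"] by simp
    ultimately show False using \<open>card (crossed_by f E) < 3\<close> by simp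
  qed
qed

text \<open>Deleting \<open>v\<close> removes the two diagonals and at most two sides, of weight 80,
  and lowers the vertex term by 57. The difference of 23 is outweighed by six crossings on the
  diagonals, worth 24.\<close>

lemma cut_degree_two:
  assumes v: "0 < v" "v + 1 < n" and two: "crossed_by (v - 1, v + 1) E = {f, g}" "f \<noteq> g"
  shows "card (crossed_by f E) + card (crossed_by g E) \<le> 5"
proof (rule ccontr)
  assume large: "\<not> ?thesis"
  have pq: "v - 1 + 2 \<le> v + 1" "v + 1 < n" "(v - 1, v + 1) \<noteq> (0, n - 1)"
    using v n_ge by auto
  have cut2: "cut (v - 1) (v + 1) = 2" using two by simp
  have fg: "f \<in> E" "g \<in> E" "v \<in> {fst f, snd f}" "v \<in> {fst g, snd g}"
  proof -
    have "f \<in> crossed_by (v - 1, v + 1) E" "g \<in> crossed_by (v - 1, v + 1) E"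
      using two by auto
    then show "f \<in> E" "g \<in> E" "v \<in> {fst f, snd f}" "v \<in> {fst g, snd g}"
      by (auto simp: crossed_by_def crosses_def)
  qed
  then have "\<not> crosses f g" "\<not> crosses g f"
    by (auto simp: crosses_def)
  then have "crossed_by g (E - {f}) = crossed_by g E"
    by (auto simp: crossed_by_def)
  then have cr: "card (crossings E)
      = card (crossings (E - {f, g})) + card (crossed_by f E) + card (crossed_by g E)"
    using card_crossings_remove[of E f] card_crossings_remove[of "E - {f}" g] finE fg two(2)
    by (simp add: insert_commute Diff_insert2[symmetric])
  have pqE: "(v - 1, v + 1) \<in> E" using cut2 pq v by (intro in_E) auto
  have "{v - 1..v + 1} = {v - 1, v, v + 1}" using v by auto
  then have "card (E \<inter> chords {v - 1..v + 1}) \<le> 3"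
    using card_triangle[of "v - 1" v "v + 1"] v by simp
  moreover have "57 * (v - 1 + 1 + n - (v + 1)) + 57 = 57 * n" using v by simp
  ultimately show False
    using split_at_chord[OF pq pqE, unfolded two(1)] cut2[unfolded two(1)] cr exceeds large by linarith
qed

section \<open>Crossings counted vertex by vertex\<close>

definition adj :: "nat \<Rightarrow> nat \<Rightarrow> bool" where
  "adj u v \<longleftrightarrow> (u, v) \<in> E \<or> (v, u) \<in> E"

definition edge_cut :: "nat \<Rightarrow> nat \<Rightarrow> nat" where
  "edge_cut u v = cut (min u v) (max u v)"

text \<open>For \<open>p < v < q\<close> these are the far ends of the edges at \<open>v\<close>
  that cross \<open>pq\<close>.\<close>

definition outside :: "nat \<Rightarrow> nat \<Rightarrow> nat \<Rightarrow> nat set" where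
  "outside p q v = {u. adj v u \<and> (u < p \<or> q < u)}"

abbreviation out :: "nat \<Rightarrow> nat \<Rightarrow> nat \<Rightarrow> nat" where
  "out p q v \<equiv> card (outside p q v)"

abbreviation ad :: "nat \<Rightarrow> nat \<Rightarrow> nat" where
  "ad u v \<equiv> of_bool (adj u v)"

text \<open>The two polygon sides at \<open>v\<close> do not count towards its degree.\<close>

definition deg :: "nat \<Rightarrow> nat" where
  "deg v = out (v - 1) (v + 1) v"

lemma adj_sym: "adj u v \<longleftrightarrow> adj v u"
  by (auto simp: adj_def)

lemma adj_less: "adj u v \<Longrightarrow> u < n \<and> v < n"
  using E_less[of u v] E_less[of v u] by (auto simp: adj_def)

lemma adj_E: "u < v \<Longrightarrow> adj u v \<longleftrightarrow> (u, v) \<in> E"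
  using E_less[of v u] by (auto simp: adj_def)

lemma finite_outside: "finite (outside p q v)"
  by (rule finite_subset[of _ "{..<n}"]) (auto simp: outside_def dest: adj_less)

text \<open>An edge crossing \<open>pq\<close> has exactly one end strictly between \<open>p\<close>
  and \<open>q\<close> and is counted there. Crossing counts thus become linear expressions in
  \<open>out\<close> and \<open>ad\<close>, open to arithmetic.\<close>

lemma cut_eq_sum:
  assumes "p < q"
  shows "cut p q = (\<Sum>v\<in>{p<..<q}. out p q v)"
proof -
  let ?f = "\<lambda>(v, u). (min v u, max v u)"
  have "bij_betw ?f (SIGMA v:{p<..<q}. outside p q v) (crossed_by (p, q) E)"
    unfolding bij_betw_def
  proof
    show "inj_on ?f (SIGMA v:{p<..<q}. outside p q v)"
      by (auto simp: inj_on_def outside_def min_def max_def split: if_splits)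
    show "?f ` (SIGMA v:{p<..<q}. outside p q v) = crossed_by (p, q) E"
    proof (intro equalityI subsetI)
      fix e assume "e \<in> ?f ` (SIGMA v:{p<..<q}. outside p q v)"
      then obtain v u where "e = (min v u, max v u)" "p < v" "v < q" "adj v u" "u < p \<or> q < u"
        by (elim imageE SigmaE) (auto simp: outside_def)
      then show "e \<in> crossed_by (p, q) E"
        by (auto simp: crossed_by_def crosses_def adj_def min_def max_def dest: E_less)
    next
      fix e assume e: "e \<in> crossed_by (p, q) E"
      obtain a b where ab: "e = (a, b)" by (cases e)
      have "(a, b) \<in> E" and "p < a \<and> a < q \<and> q < b \<or> a < p \<and> p < b \<and> b < q"
        using e ab by (auto simp: crossed_by_def crosses_def)
      then show "e \<in> ?f ` (SIGMA v:{p<..<q}. outside p q v)"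
      proof (elim disjE)
        assume "(a, b) \<in> E" "p < a \<and> a < q \<and> q < b"
        then show ?thesis
          using ab by (intro image_eqI[of _ _ "(a, b)"]) (auto simp: outside_def adj_def)
      next
        assume "(a, b) \<in> E" "a < p \<and> p < b \<and> b < q"
        then show ?thesis
          using ab by (intro image_eqI[of _ _ "(b, a)"]) (auto simp: outside_def adj_def)
      qed
    qed
  qed
  then have "cut p q = card (SIGMA v:{p<..<q}. outside p q v)"
    by (simp add: bij_betw_same_card)
  then show ?thesis
    by (simp add: finite_outside)
qed

lemma out_right:
  assumes "p \<le> r" "r = q + 1"
  shows "out p q v = out p r v + ad v r"
proof -
  have "q < u \<longleftrightarrow> u = r \<or> r < u" for u using assms by auto
  then have "outside p q v = outside p r v \<union> (if adj v r then {r} else {})"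
    by (auto simp: outside_def)
  moreover have "r \<notin> outside p r v" using assms by (auto simp: outside_def)
  ultimately show ?thesis by (simp add: finite_outside)
qed

lemma out_left:
  assumes "p \<le> q" "r = p + 1"
  shows "out r q v = out p q v + ad v p"
proof -
  have "u < r \<longleftrightarrow> u = p \<or> u < p" for u using assms by auto
  then have "outside r q v = outside p q v \<union> (if adj v p then {p} else {})"
    by (auto simp: outside_def)
  moreover have "p \<notin> outside p q v" using assms by (auto simp: outside_def)
  ultimately show ?thesis by (simp add: finite_outside)
qed

lemma edge_cut_le: "adj u v \<Longrightarrow> edge_cut u v \<le> 4"
  unfolding edge_cut_def adj_def
  by (rule edge_le) (auto simp: min_def max_def dest: E_less)

text \<open>The thresholds 4 and 5 leave no gap, so the crossing count of a chord decides whether it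
  is an edge.\<close>

lemma cut_adj: "p < q \<Longrightarrow> q < n \<Longrightarrow> if adj p q then cut p q \<le> 4 else 5 \<le> cut p q"
  using edge_le[of "(p, q)"] nonedge_ge[of "(p, q)"] by (auto simp: adj_E chords_def)

lemma cut_2: "v = i + 1 \<Longrightarrow> j = i + 2 \<Longrightarrow> cut i j = deg v"
proof -
  assume *: "v = i + 1" "j = i + 2"
  then have "{i<..<j} = {v}" by auto
  then show ?thesis using * by (simp add: cut_eq_sum deg_def)
qed

lemma cut_3: "u = i + 1 \<Longrightarrow> v = i + 2 \<Longrightarrow> j = i + 3 \<Longrightarrow> cut i j = out i j u + out i j v"
proof -
  assume *: "u = i + 1" "v = i + 2" "j = i + 3"
  then have "{i<..<j} = {u, v}" by auto
  then show ?thesis using * by (simp add: cut_eq_sum)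
qed

lemma cut_4:
  "u = i + 1 \<Longrightarrow> v = i + 2 \<Longrightarrow> w = i + 3 \<Longrightarrow> j = i + 4 \<Longrightarrow> cut i j = out i j u + out i j v + out i j w"
proof -
  assume *: "u = i + 1" "v = i + 2" "w = i + 3" "j = i + 4"
  then have "{i<..<j} = {u, v, w}" by auto
  then show ?thesis using * by (simp add: cut_eq_sum)
qed

lemma cut_5:
  "u = i + 1 \<Longrightarrow> v = i + 2 \<Longrightarrow> w = i + 3 \<Longrightarrow> x = i + 4 \<Longrightarrow> j = i + 5 \<Longrightarrow>
    cut i j = out i j u + out i j v + out i j w + out i j x"
proof -
  assume *: "u = i + 1" "v = i + 2" "w = i + 3" "x = i + 4" "j = i + 5"
  then have "{i<..<j} = {u, v, w, x}" by auto
  then show ?thesis using * by (simp add: cut_eq_sum)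
qed

lemma short_chord:
  assumes "v = i + 1" "j = i + 2" "j < n"
  shows "2 \<le> deg v" "if adj i j then deg v \<le> 4 else 5 \<le> deg v"
proof -
  have ij: "(i, j) \<noteq> (0, n - 1)" using assms n_ge by auto
  show "2 \<le> deg v"
    using cut_ge_2[OF _ _ ij] assms cut_2[OF assms(1,2)] by simp
  show "if adj i j then deg v \<le> 4 else 5 \<le> deg v"
    using cut_adj[of i j, unfolded cut_2[OF assms(1,2)]] assms by simp
qed

text \<open>Every edge in \<open>F\<close> separates \<open>v\<close> from all vertices outside
  \<open>{p..q}\<close>, so the edge \<open>vx\<close> has to cross it.\<close>

lemma edge_cut_ge:
  assumes "adj v x" "x < p \<or> q < x" "F \<subseteq> E"
    "\<And>a b. (a, b) \<in> F \<Longrightarrow> p \<le> a \<and> a < v \<and> v < b \<and> b \<le> q"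
  shows "card F \<le> edge_cut v x"
  unfolding edge_cut_def
proof (intro card_mono finite_crossed_by finE subsetI)
  fix e assume e: "e \<in> F"
  obtain a b where ab: "e = (a, b)" by (cases e)
  show "e \<in> crossed_by (min v x, max v x) E"
    using assms(2,3) assms(4)[of a b] e ab
    by (auto simp: crossed_by_def crosses_def min_def max_def)
qed

lemma degree_two:
  assumes "deg v = 2" "u = v - 1" "w = v + 1" "0 < v" "w < n"
    and xy: "adj v x" "adj v y" "x \<noteq> y" "x < u \<or> w < x" "y < u \<or> w < y"
  shows "edge_cut v x + edge_cut v y \<le> 5"
proof -
  let ?e = "\<lambda>x. (min v x, max v x)"
  have ne: "?e x \<noteq> ?e y" using xy(3) by (auto simp: min_def max_def split: if_splits)
  have *: "?e z \<in> crossed_by (u, w) E" if "adj v z" "z < u \<or> w < z" for z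
    using that assms(2-4) E_less[of z v] E_less[of v z]
    by (auto simp: crossed_by_def crosses_def min_def max_def adj_def)
  have "card (crossed_by (u, w) E) = 2"
    using assms(1-4) cut_2[of v u w] by simp
  then have "{?e x, ?e y} = crossed_by (u, w) E"
    using * xy ne by (intro card_seteq) (auto simp: finite_crossed_by finE)
  then show ?thesis
    using cut_degree_two[of v "?e x" "?e y"] ne assms(2-5) by (simp add: edge_cut_def)
qed

section \<open>Edges cutting off few vertices\<close>

text \<open>If \<open>av\<close> were missing, \<open>u\<close> would send at least four edges
  across \<open>ab\<close> and \<open>v\<close> at least two, against a total of 4. If
  \<open>u\<close> had degree 4, then \<open>v\<close> would have degree 2, with \<open>va\<close>
  crossed four times and the other diagonal by \<open>ab\<close> and \<open>ub\<close>: six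
  crossings where \<open>degree_two\<close> allows five. The rest is symmetric.\<close>

lemma quad:
  assumes "u = a + 1" "v = a + 2" "b = a + 3" and adj: "adj a b"
  shows "adj a v" "adj u b" "deg u = out a b u + 1" "deg v = out a b v + 1"
    "1 \<le> out a b u" "1 \<le> out a b v" "deg u \<le> 3" "deg v \<le> 3"
proof -
  have n: "b < n" "a < n" using adj adj_less by blast+
  have c: "out a b u + out a b v \<le> 4"
    using cut_adj[of a b] cut_3[OF assms(1-3)] adj n assms by simp
  have d1: "deg u = out a b u + ad u b"
    using out_right[of a b v u] assms by (simp add: deg_def)
  have d2: "deg v = out a b v + ad a v"
    using out_left[of a b u v] assms adj_sym[of a v] by (simp add: deg_def eval_nat_numeral)
  note s = short_chord[of u a v] short_chord[of v u b]
  show adj1: "adj a v" and adj2: "adj u b"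
    using c d1 d2 s assms n by (auto split: if_splits)
  show e1: "deg u = out a b u + 1" and e2: "deg v = out a b v + 1"
    using d1 d2 adj1 adj2 by auto
  show o1: "1 \<le> out a b u" and o2: "1 \<le> out a b v"
    using e1 e2 s assms n by (auto split: if_splits)
  show "deg u \<le> 3"
  proof (rule ccontr)
    assume "\<not> ?thesis"
    then have 2: "deg v = 2" and 4: "deg u = 4"
      using c o2 e1 e2 by auto
    obtain x where "x \<in> outside a b v" using o2 by fastforce
    then have x: "adj v x" "x < a \<or> b < x" by (auto simp: outside_def)
    have "card {(a, b), (u, b)} \<le> edge_cut v x"
      using x adj adj2 assms by (intro edge_cut_ge[of _ _ a b]) (auto simp: adj_E)
    moreover have "edge_cut v a = 4" using 4 cut_2[of u a v] assms by (simp add: edge_cut_def)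
    moreover have "edge_cut v x + edge_cut v a \<le> 5"
      using 2 x adj1[unfolded adj_sym[of a]] n assms by (intro degree_two[of v u b]) auto
    ultimately show False using assms by simp
  qed
  show "deg v \<le> 3"
  proof (rule ccontr)
    assume "\<not> ?thesis"
    then have 2: "deg u = 2" and 4: "deg v = 4"
      using c o1 e1 e2 by auto
    obtain x where "x \<in> outside a b u" using o1 by fastforce
    then have x: "adj u x" "x < a \<or> b < x" by (auto simp: outside_def)
    have "card {(a, b), (a, v)} \<le> edge_cut u x"
      using x adj adj1 assms by (intro edge_cut_ge[of _ _ a b]) (auto simp: adj_E)
    moreover have "edge_cut u b = 4" using 4 cut_2[of v u b] assms by (simp add: edge_cut_def)
    moreover have "edge_cut u x + edge_cut u b \<le> 5"
      using 2 x adj2 n assms by (intro degree_two[of u a v]) auto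
    ultimately show False using assms by simp
  qed
qed

text \<open>Once \<open>aw\<close> and \<open>ub\<close> are edges, \<open>quad\<close> bounds the
  degrees by 3, so each middle vertex sends at most one edge across \<open>ab\<close>. As
  \<open>ab\<close> is crossed at least twice, a vertex sending none would have degree 2 while the
  other two send one each; its diagonals would then have six or more crossings, against
  \<open>degree_two\<close>.\<close>

lemma pentagon:
  assumes "u = a + 1" "v = a + 2" "w = a + 3" "b = a + 4" and adj: "adj a b"
  shows "adj a v" "adj u w" "adj v b" "adj a w" "adj u b"
    "out a b u = 1" "out a b v = 1" "out a b w = 1" "deg u = 3" "deg v = 3" "deg w = 3"
proof -
  have n: "b < n" "a < n" using adj adj_less by blast+
  have ab: "(a, b) \<noteq> (0, n - 1)" using assms n_ge by auto
  have c: "out a b u + out a b v + out a b w \<le> 4" "2 \<le> out a b u + out a b v + out a b w"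
    using cut_adj[of a b] cut_ge_2[OF _ _ ab] cut_4[OF assms(1-4)] adj n assms by simp_all
  have o1: "out a w u = out a b u + ad u b" and o2: "out a w v = out a b v + ad v b"
    using out_right[of a b w] assms by simp_all
  have o3: "out u b v = out a b v + ad a v" and o4: "out u b w = out a b w + ad a w"
    using out_left[of a b u] assms adj_sym by simp_all
  have d1: "deg u = out a b u + ad u b + ad u w"
    using out_right[of a w v u] o1 assms by (simp add: deg_def)
  have d2: "deg v = out a b v + ad a v + ad v b"
    using out_right[of u b w v] o3 assms by (simp add: deg_def eval_nat_numeral)
  have d3: "deg w = out a b w + ad a w + ad u w"
    using out_left[of u b v w] o4 assms adj_sym[of u w] by (simp add: deg_def eval_nat_numeral)
  note s = short_chord[of u a v] short_chord[of v u w] short_chord[of w v b]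
  have q1: "if adj a w then out a w u + out a w v \<le> 4 else 5 \<le> out a w u + out a w v"
    using cut_adj[of a w, unfolded cut_3[OF assms(1-3)]] assms n by simp
  have vwb: "v = u + 1" "w = u + 2" "b = u + 3" using assms by auto
  have q2: "if adj u b then out u b v + out u b w \<le> 4 else 5 \<le> out u b v + out u b w"
    using cut_adj[of u b, unfolded cut_3[OF vwb]] assms n by simp
  note Q1 = quad[of u a v w] and Q2 = quad[of v u w b]
  \<comment> \<open>This configuration would arise if \<open>aw\<close> were missing:
    \<open>wu\<close> is crossed by the three diagonals at \<open>v\<close>, and \<open>wx\<close>
    by the three edges from \<open>b\<close>, six in all. \<open>two_u\<close> is its mirror
    image.\<close>
  have two_w: False if 2: "deg w = 2" and "deg v = 3" and x: "adj w x" "x < a \<or> b < x"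
    and h: "adj u w" "adj v b" "adj u b" for x
  proof -
    have "card {(a, b), (v, b), (u, b)} \<le> edge_cut w x"
      using x adj h assms by (intro edge_cut_ge[of _ _ a b]) (auto simp: adj_E)
    moreover have "edge_cut w u = 3" using that cut_2[of v u w] assms by (simp add: edge_cut_def)
    moreover have "edge_cut w x + edge_cut w u \<le> 5"
      using 2 x h(1)[unfolded adj_sym[of u]] n assms by (intro degree_two[of w v b]) auto
    ultimately show False using assms by simp
  qed
  have two_u: False if 2: "deg u = 2" and "deg v = 3" and x: "adj u x" "x < a \<or> b < x"
    and h: "adj u w" "adj a v" "adj a w" for x
  proof -
    have "card {(a, b), (a, v), (a, w)} \<le> edge_cut u x"
      using x adj h assms by (intro edge_cut_ge[of _ _ a b]) (auto simp: adj_E)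
    moreover have "edge_cut u w = 3" using that cut_2[of v u w] assms by (simp add: edge_cut_def)
    moreover have "edge_cut u x + edge_cut u w \<le> 5"
      using 2 x h(1) n assms by (intro degree_two[of u a v]) auto
    ultimately show False using assms by simp
  qed
  \<comment> \<open>With both missing, the counts put all four crossings of \<open>ab\<close> at
    \<open>v\<close>. Then \<open>v\<close> has degree 6, so \<open>uw\<close> is missing too, and
    no diagonal is left at \<open>u\<close>.\<close>
  have g: "adj a w \<or> adj u b"
  proof (rule ccontr)
    assume "\<not> ?thesis"
    then have no: "\<not> adj a w" "\<not> adj u b" by auto
    then show False
      using c q1 q2 o1 o2 o3 o4 d1 d2 s assms n by (cases "adj u w"; cases "adj a v"; cases "adj v b") auto
  qed
  have g1: "adj a w"
  proof (rule ccontr)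
    assume no: "\<not> adj a w"
    then have b: "adj u b" using g by simp
    have e: "adj u w" "adj v b" "deg v \<le> 3" "deg w \<le> 3"
      using Q2 vwb b by auto
    have "out a b u \<le> 2"
      using c q1 no b e o1 o2 d1 d2 d3 s assms n by (cases "adj a v") auto
    then have "adj a v"
      using d1 s b e assms n by (cases "adj a v") auto
    then have "deg w = 2" "deg v = 3" "out a b w = 1"
      using c q1 no b e o1 o2 d1 d2 d3 s \<open>out a b u \<le> 2\<close> assms n by auto
    moreover obtain x where "x \<in> outside a b w"
      using \<open>out a b w = 1\<close> card_1_singletonE by blast
    then have "adj w x" "x < a \<or> b < x" by (auto simp: outside_def)
    ultimately show False by (intro two_w[of x]) (use e b in auto)
  qed
  have e1: "adj a v" "adj u w" "deg u \<le> 3" "deg v \<le> 3"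
    using Q1 assms g1 by auto
  have g2: "adj u b"
  proof (rule ccontr)
    assume no: "\<not> adj u b"
    have "out a b w \<le> 2"
      using c q2 no g1 e1 o3 o4 d1 d2 d3 s assms n by (cases "adj v b") auto
    then have "adj v b"
      using d3 s g1 e1 assms n by (cases "adj v b") auto
    then have "deg u = 2" "deg v = 3" "out a b u = 1"
      using c q2 no g1 e1 o3 o4 d1 d2 d3 s \<open>out a b w \<le> 2\<close> assms n by auto
    moreover obtain x where "x \<in> outside a b u"
      using \<open>out a b u = 1\<close> card_1_singletonE by blast
    then have "adj u x" "x < a \<or> b < x" by (auto simp: outside_def)
    ultimately show False by (intro two_u[of x]) (use e1 g1 in auto)
  qed
  have e2: "adj v b" "deg w \<le> 3"
    using Q2 vwb g2 by auto
  have D: "deg u = out a b u + 2" "deg v = out a b v + 2" "deg w = out a b w + 2"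
    using d1 d2 d3 e1 e2 g1 g2 by auto
  have ec: "edge_cut v a = deg u" "edge_cut u w = deg v" "edge_cut w u = deg v" "edge_cut v b = deg w"
    using cut_2[of u a v] cut_2[of v u w] cut_2[of w v b] assms by (auto simp: edge_cut_def)
  have ec': "edge_cut w a = out a b u + out a b v + 2" "edge_cut u b = out a b v + out a b w + 2"
    using cut_3[OF assms(1-3)] cut_3[OF vwb] o1 o2 o3 o4 e1 e2 g1 g2 assms by (auto simp: edge_cut_def)
  have "deg u \<noteq> 2"
  proof
    assume 2: "deg u = 2"
    then have "edge_cut u w + edge_cut u b \<le> 5"
      using e1 g2 n assms by (intro degree_two[of u a v]) auto
    then show False using c D e1 e2 2 ec ec' by auto
  qed
  moreover have "deg v \<noteq> 2"
  proof
    assume 2: "deg v = 2"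
    then have "edge_cut v a + edge_cut v b \<le> 5"
      using e1(1)[unfolded adj_sym[of a]] e2 n assms by (intro degree_two[of v u w]) auto
    then show False using c D e1 e2 2 ec by auto
  qed
  moreover have "deg w \<noteq> 2"
  proof
    assume 2: "deg w = 2"
    then have "edge_cut w u + edge_cut w a \<le> 5"
      using e1(2)[unfolded adj_sym[of u]] g1[unfolded adj_sym[of a]] n assms
      by (intro degree_two[of w v b]) auto
    then show False using c D e1 e2 2 ec ec' by auto
  qed
  ultimately show "out a b u = 1" "out a b v = 1" "out a b w = 1" "deg u = 3" "deg v = 3" "deg w = 3"
    using D e1 e2 by auto
  show "adj a v" "adj u w" "adj v b" "adj a w" "adj u b" by fact+
qed

end

section \<open>Polygons with at most six vertices\<close>

text \<open>An executable enumeration, so that the counts for small polygons come from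
  evaluation.\<close>

definition chord_list :: "nat \<Rightarrow> (nat \<times> nat) list" where
  "chord_list n = filter (\<lambda>(a, b). a < b) (List.product [0..<n] [0..<n])"

lemma chords_eq_chord_list: "chords {..<n} = set (chord_list n)"
  by (auto simp: chords_def chord_list_def)

lemma distinct_chord_list: "distinct (chord_list n)"
  by (simp add: chord_list_def distinct_product)

lemma card_chords: "card (chords {..<n}) = length (chord_list n)"
  by (simp add: chords_eq_chord_list distinct_card distinct_chord_list)

lemma card_crossings_chords:
  "card (crossings (chords {..<n}))
     = length (filter (\<lambda>(e, f). crosses e f) (List.product (chord_list n) (chord_list n)))"
proof -
  have "crossings (chords {..<n})
      = set (filter (\<lambda>(e, f). crosses e f) (List.product (chord_list n) (chord_list n)))"
    by (auto simp: crossings_def chords_eq_chord_list)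
  then show ?thesis
    by (simp only: distinct_card distinct_filter distinct_product distinct_chord_list)
qed

lemma length_chord_list:
  "length (chord_list 3) = 3" "length (chord_list 4) = 6"
  "length (chord_list 5) = 10" "length (chord_list 6) = 15"
  by code_simp+

lemma crossings_5: "card (crossings (chords {..<5::nat})) = 5"
  unfolding card_crossings_chords by code_simp

lemma crossings_6: "card (crossings (chords {..<6::nat})) = 15"
  unfolding card_crossings_chords by code_simp

lemma crossed_by_6:
  assumes "e \<in> chords {..<6::nat}"
  shows "card (crossed_by e (chords {..<6})) \<le> 4"
proof -
  have "\<forall>e\<in>set (chord_list 6). length (filter (\<lambda>f. crosses e f \<or> crosses f e) (chord_list 6)) \<le> 4"
    by code_simp
  moreover have "crossed_by e (chords {..<6}) = set (filter (\<lambda>f. crosses e f \<or> crosses f e) (chord_list 6))"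
    by (auto simp: crossed_by_def chords_eq_chord_list)
  ultimately show ?thesis
    using assms card_length order_trans unfolding chords_eq_chord_list by fastforce
qed
context minimal_counterexample
begin

text \<open>No chord of a hexagon has 5 crossings, so there is no non-edge, and the complete graph
  attains equality in the bound. This case has to go because a run of four small degrees would
  otherwise be possible in it.\<close>

lemma n_neq_6: "n \<noteq> 6"
proof
  assume n: "n = 6"
  have "E = chords {..<6}"
  proof (rule ccontr)
    assume "E \<noteq> chords {..<6}"
    then obtain e where e: "e \<in> chords {..<n}" "e \<notin> E" using E_sub n by auto
    have "card (crossed_by e E) \<le> card (crossed_by e (chords {..<6}))"
      using E_sub n by (intro card_mono) (auto simp: crossed_by_def finite_chords)
    then show False using nonedge_ge[OF e] crossed_by_6[of e] e n by auto
  qed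
  then show False
    using exceeds n crossings_6 card_chords[of 6] length_chord_list by simp
qed

end

section \<open>A shortest edge cutting off at least four vertices\<close>

locale minimal_chord = minimal_counterexample +
  fixes p q :: nat
  assumes pq: "adj p q" "p + 5 \<le> q"
    and inner: "\<And>i j. adj i j \<Longrightarrow> p \<le> i \<Longrightarrow> i < j \<Longrightarrow> j \<le> q \<Longrightarrow> (i, j) \<noteq> (p, q) \<Longrightarrow> j \<le> i + 4"
begin

lemma q_less: "q < n"
  using pq adj_less by blast

lemma cut_pq: "(\<Sum>v\<in>{p<..<q}. out p q v) \<le> 4"
  using cut_adj[of p q] cut_eq_sum[of p q] pq q_less by simp

text \<open>\<open>b - a - 1\<close> is the number of vertices cut off, and each of them has an edge
  across \<open>ab\<close>.\<close>

lemma cut_small: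
  assumes "adj a b" "a < b" "b \<le> a + 4"
  shows "b - a - 1 \<le> cut a b"
proof -
  have "b < n" using assms adj_less by blast
  consider "b = a + 1" | "b = a + 2" | "b = a + 3" | "b = a + 4"
    using assms(2,3) by linarith
  then show ?thesis
  proof cases
    case 2
    then show ?thesis
      using short_chord[of "a + 1" a b] cut_2[of "a + 1" a b] \<open>b < n\<close> by simp
  next
    case 3
    then show ?thesis
      using quad[of "a + 1" a "a + 2" b] cut_3[of "a + 1" a "a + 2" b] assms(1) by simp
  next
    case 4
    then show ?thesis
      using pentagon[of "a + 1" a "a + 2" "a + 3" b] cut_4[of "a + 1" a "a + 2" "a + 3" b] assms(1)
      by simp
  qed simp
qed

lemma deg_le_4_under:
  assumes "adj a b" "a < v" "v < b" "b \<le> a + 4"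
  shows "deg v \<le> 4"
proof -
  have "b < n" using assms adj_less by blast
  consider "b = a + 2" "v = a + 1" | "b = a + 3" "v = a + 1" | "b = a + 3" "v = a + 2"
    | "b = a + 4" "v = a + 1" | "b = a + 4" "v = a + 2" | "b = a + 4" "v = a + 3"
  proof -
    obtain d where d: "v = a + d" using assms(2) less_imp_add_positive by blast
    obtain c where c: "b = a + c" using assms(2,3) less_imp_add_positive[of a b] by auto
    have "c = 2 \<and> d = 1 \<or> c = 3 \<and> d = 1 \<or> c = 3 \<and> d = 2 \<or> c = 4 \<and> d = 1 \<or> c = 4 \<and> d = 2 \<or> c = 4 \<and> d = 3"
      using assms(2-4) unfolding c d by presburger
    then show thesis using that c d by blast
  qed
  then show ?thesis
  proof cases
    case 1
    then show ?thesis using short_chord(2)[of v a b] assms(1) \<open>b < n\<close> by simp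
  next
    case 2
    then show ?thesis using quad(7)[of v a "a + 2" b] assms(1) by simp
  next
    case 3
    then show ?thesis using quad(8)[of "a + 1" a v b] assms(1) by simp
  next
    case 4
    then show ?thesis using pentagon(9)[of v a "a + 2" "a + 3" b] assms(1) by simp
  next
    case 5
    then show ?thesis using pentagon(10)[of "a + 1" a v "a + 3" b] assms(1) by simp
  next
    case 6
    then show ?thesis using pentagon(11)[of "a + 1" a "a + 2" v b] assms(1) by simp
  qed
qed

text \<open>
  No inner edge passes over a vertex \<open>v\<close> of larger degree. So \<open>pv\<close> and \<open>vq\<close> are edges, crossed only by
  edges that also cross \<open>pq\<close>, and at least as often as they cut off vertices. This leaves at most
  four diagonals at \<open>v\<close>.
\<close>

lemma deg_le_4:
  assumes v: "p < v" "v < q"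
  shows "deg v \<le> 4"
proof (rule ccontr)
  assume big: "\<not> deg v \<le> 4"
  have over: "\<not> adj a b" if "p \<le> a" "a < v" "v < b" "b \<le> q" "(a, b) \<noteq> (p, q)" for a b
    using that big deg_le_4_under[of a b v] inner[of a b] by auto
  have "outside p v u = outside p q u" if "p < u" "u < v" for u
    using that over[of u] v by (force simp: outside_def)
  then have L: "cut p v = (\<Sum>u\<in>{p<..<v}. out p q u)"
    using v by (simp add: cut_eq_sum)
  have "outside v q u = outside p q u" if u: "v < u" "u < q" for u
  proof -
    have "x < p" if "adj u x" "x < v" for x
    proof (rule ccontr)
      assume "\<not> x < p"
      then show False
        using over[of x u] that u adj_sym[of u x] by simp
    qed
    then show ?thesis using v by (fastforce simp: outside_def)
  qed
  then have R: "cut v q = (\<Sum>u\<in>{v<..<q}. out p q u)"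
    using v by (simp add: cut_eq_sum)
  have "{p<..<q} = insert v ({p<..<v} \<union> {v<..<q})" using v by auto
  then have sum: "(\<Sum>u\<in>{p<..<q}. out p q u) = cut p v + out p q v + cut v q"
    unfolding L R by (subst \<open>{p<..<q} = _\<close>, subst sum.insert) (auto simp: sum.union_disjoint)
  then have "cut p v \<le> 4" "cut v q \<le> 4" using cut_pq by auto
  then have "adj p v" "adj v q"
    using cut_adj[of p v] cut_adj[of v q] v q_less by (auto split: if_splits)
  then have le: "v - p - 1 \<le> cut p v" "q - v - 1 \<le> cut v q"
    using v cut_small[of p v] cut_small[of v q] inner[of p v] inner[of v q] by auto
  \<comment> \<open>The two intervals have as many elements as \<open>pv\<close> and
    \<open>vq\<close> cut off vertices. Hence the degree is at most
    \<open>out p q v + cut p v + cut v q\<close>, the number of crossings of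
    \<open>pq\<close>.\<close>
  have "outside (v - 1) (v + 1) v \<subseteq> outside p q v \<union> {p..<v - 1} \<union> {v + 2..q}"
    by (auto simp: outside_def)
  then have "deg v \<le> card (outside p q v \<union> {p..<v - 1} \<union> {v + 2..q})"
    unfolding deg_def by (intro card_mono) (auto simp: finite_outside)
  also have "\<dots> \<le> out p q v + card {p..<v - 1} + card {v + 2..q}"
    by (meson add_le_mono card_Un_le le_refl order_trans)
  also have "\<dots> = out p q v + (v - p - 1) + (q - v - 1)" using v by simp
  finally show False using le sum cut_pq big by linarith
qed

section \<open>Chords over runs of vertices of small degree\<close>

lemma inner_short:
  assumes "p \<le> i" "v = i + 1" "j = i + 2" "j \<le> q"
  shows "adj i j" "2 \<le> deg v" "deg v \<le> 4"
  using short_chord[of v i j] deg_le_4[of v] assms q_less by (auto split: if_splits)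

text \<open>As \<open>iv\<close> and \<open>uj\<close> are edges, \<open>ij\<close> is crossed
  \<open>deg u + deg v - 2\<close> times. Degrees 2 and 4 would pass the threshold, but
  \<open>quad\<close> rules them out.\<close>

lemma inner_chord_3:
  assumes "p \<le> i" "u = i + 1" "v = i + 2" "j = i + 3" "j \<le> q"
  shows "if deg u \<le> 3 \<and> deg v \<le> 3 then adj i j else \<not> adj i j \<and> 7 \<le> deg u + deg v"
proof -
  have s: "adj i v" "adj u j" using inner_short[of i u v] inner_short[of u v j] assms by auto
  have "deg u = out i j u + 1"
    using out_right[of i j v u] s assms by (simp add: deg_def)
  moreover have "deg v = out i j v + 1"
    using out_left[of i j u v] s adj_sym[of i v] assms by (simp add: deg_def eval_nat_numeral)
  ultimately have "if adj i j then deg u + deg v \<le> 6 else 7 \<le> deg u + deg v"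
    using cut_adj[of i j, unfolded cut_3[OF assms(2-4)]] assms q_less by auto
  then show ?thesis
    using quad(7,8)[of u i v j] assms by (auto split: if_splits)
qed

text \<open>All other chords of the pentagon are edges, and each middle vertex has two of them as
  diagonals. So at most one edge per vertex is left to cross \<open>ij\<close>.\<close>

lemma inner_chord_4:
  assumes "p \<le> i" "u = i + 1" "v = i + 2" "w = i + 3" "j = i + 4" "j \<le> q"
    and "deg u \<le> 3" "deg v \<le> 3" "deg w \<le> 3"
  shows "adj i j"
proof -
  have a: "adj u w" "adj i w" "adj u j" "adj i v" "adj v j"
    using inner_short[of u v w] inner_short[of i u v] inner_short[of v w j]
      inner_chord_3[of i u v w] inner_chord_3[of u v w j] assms by auto
  have "deg u = out i j u + 2"
    using out_right[of i w v u] out_right[of i j w u] a assms by (simp add: deg_def)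
  moreover have "deg v = out i j v + 2"
    using out_left[of i w u v] out_right[of i j w v] a adj_sym[of i v] assms
    by (simp add: deg_def eval_nat_numeral)
  moreover have "deg w = out i j w + 2"
    using out_left[of u j v w] out_left[of i j u w] a adj_sym[of i w] adj_sym[of u w] assms
    by (simp add: deg_def eval_nat_numeral)
  ultimately show ?thesis
    using cut_adj[of i j, unfolded cut_4[OF assms(2-5)]] assms q_less by (auto split: if_splits)
qed

text \<open>The pentagons on \<open>i..x\<close> and \<open>u..j\<close> overlap. The single edge
  that a middle vertex sends out of either one goes to the sixth vertex, so nothing crosses
  \<open>ij\<close>; hence \<open>ij\<close> is the side \<open>(0, n - 1)\<close> and
  \<open>n = 6\<close>.\<close>

lemma no_run_of_4:
  assumes "p \<le> i" "u = i + 1" "v = i + 2" "w = i + 3" "x = i + 4" "j = i + 5" "j \<le> q"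
  shows "\<not> (deg u \<le> 3 \<and> deg v \<le> 3 \<and> deg w \<le> 3 \<and> deg x \<le> 3)"
proof
  assume d: "deg u \<le> 3 \<and> deg v \<le> 3 \<and> deg w \<le> 3 \<and> deg x \<le> 3"
  have a: "adj i x" "adj u j"
    using inner_chord_4[of i u v w x] inner_chord_4[of u v w x j] d assms by auto
  have u: "v = u + 1" "w = u + 2" "x = u + 3" "j = u + 4" using assms by auto
  note P = pentagon[OF assms(2-5) a(1)] pentagon[OF u a(2)]
  have "out i j u = 0" "out i j v = 0"
    using out_right[of i j x u] out_right[of i j x v] P a assms by auto
  moreover have "out i j w = 0" "out i j x = 0"
    using out_left[of i j u w] out_left[of i j u x] P a adj_sym[of i] assms by auto
  ultimately have "cut i j = 0"
    using cut_5[OF assms(2-6)] by simp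
  then have "(i, j) = (0, n - 1)"
    using cut_pos[of i j] assms q_less by fastforce
  then show False using assms n_neq_6 n_ge by auto
qed

text \<open>
  The third diagonal at the middle vertex of a run is already crossed four times by the chords of
  the pentagon. Hence it cannot cross \<open>pq\<close> as well, and it extends the run.
\<close>

lemma no_run_of_3:
  assumes "p \<le> i" "u = i + 1" "v = i + 2" "w = i + 3" "j = i + 4" "j \<le> q"
  shows "\<not> (deg u \<le> 3 \<and> deg v \<le> 3 \<and> deg w \<le> 3)"
proof
  assume d: "deg u \<le> 3 \<and> deg v \<le> 3 \<and> deg w \<le> 3"
  have a: "adj i j" using inner_chord_4[of i u v w j] d assms by auto
  note P = pentagon[OF assms(2-5) a]
  obtain x where "x \<in> outside i j v"
    using P(7) card_1_singletonE by blast
  then have x: "adj v x" "x < i \<or> j < x" by (auto simp: outside_def)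
  have "p \<le> x \<and> x \<le> q"
  proof (rule ccontr)
    assume "\<not> (p \<le> x \<and> x \<le> q)"
    then have "card {(u, w), (i, w), (u, j), (i, j), (p, q)} \<le> edge_cut v x"
    proof (intro edge_cut_ge[of _ _ p q])
      show "{(u, w), (i, w), (u, j), (i, j), (p, q)} \<subseteq> E"
        using P(2,4,5) a pq assms(1-5) adj_E by simp
      show "p \<le> b \<and> b < v \<and> v < c \<and> c \<le> q"
        if "(b, c) \<in> {(u, w), (i, w), (u, j), (i, j), (p, q)}" for b c
        using that assms by auto
    qed (use x in auto)
    moreover have "distinct [(u, w), (i, w), (u, j), (i, j), (p, q)]"
      using assms pq by auto
    then have "card {(u, w), (i, w), (u, j), (i, j), (p, q)} = 5"
      using distinct_card by fastforce
    ultimately show False using edge_cut_le[OF x(1)] by simp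
  qed
  \<comment> \<open>Now \<open>vx\<close> is an inner edge and spans at most four steps, so
    \<open>quad\<close> or \<open>pentagon\<close> bounds the degree of the vertex next to the
    run.\<close>
  then consider "j < x" "x \<le> i + 6" "x \<le> q" | "x < i" "i \<le> x + 2" "p \<le> x"
    using inner[of v x] inner[of x v] x adj_sym[of v x] assms by force
  then show False
  proof cases
    case 1
    then have "x = i + 5 \<or> x = i + 6" using assms by auto
    then have "deg j \<le> 3"
    proof
      assume "x = i + 5"
      then have "w = v + 1" "j = v + 2" "x = v + 3" using assms by auto
      from quad(8)[OF this x(1)] show ?thesis .
    next
      assume "x = i + 6"
      then have "w = v + 1" "j = v + 2" "i + 5 = v + 3" "x = v + 4" using assms by auto
      from pentagon(10)[OF this x(1)] show ?thesis by simp
    qed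
    then show False
      using no_run_of_4[of i u v w j "i + 5"] 1 d assms by auto
  next
    case 2
    then have *: "x + 1 = i \<or> x + 2 = i" and "p \<le> i - 1" by auto
    have "adj x v" using x(1) adj_sym by blast
    have "deg i \<le> 3"
      using *
    proof
      assume "x + 1 = i"
      then have "i = x + 1" "u = x + 2" "v = x + 3" using assms by auto
      from quad(7)[OF this \<open>adj x v\<close>] show ?thesis .
    next
      assume "x + 2 = i"
      then have "x + 1 = x + 1" "i = x + 2" "u = x + 3" "v = x + 4" using assms by auto
      from pentagon(10)[OF this \<open>adj x v\<close>] show ?thesis by simp
    qed
    then show False
      using no_run_of_4[of "i - 1" i u v w j] 2 d assms \<open>p \<le> i - 1\<close> by auto
  qed
qed

text \<open>Let \<open>u\<close> to \<open>y\<close> be the five vertices after \<open>p\<close>.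
  Within \<open>pq\<close> the diagonals at \<open>u\<close> lead only to \<open>w\<close> and
  \<open>x\<close>, those at \<open>v\<close> only to \<open>p\<close>, \<open>x\<close> and
  \<open>y\<close>. If \<open>u\<close> or \<open>v\<close> has degree 4, the two degrees sum to at
  least 7, and \<open>ux\<close> and \<open>vy\<close> are not both edges, so at most 4 stay inside.
  Otherwise \<open>w\<close> has degree 4, \<open>ux\<close> and \<open>vy\<close> are missing and
  \<open>deg v = 3\<close>; only \<open>deg u = 2\<close> could fail then, and \<open>two\<close>
  excludes it.\<close>

lemma left_end: "3 \<le> out p q (p + 1) + out p q (p + 2)"
proof -
  define u v w x y where "u = p + 1" "v = p + 2" "w = p + 3" "x = p + 4" "y = p + 5"
  note e = this
  have yq: "y \<le> q" using pq e by simp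
  \<comment> \<open>Such an edge would span a pentagon whose middle vertices form a forbidden run of
    three.\<close>
  have no5: "\<not> adj u y"
    using pentagon(9-11)[of v u w x y] no_run_of_3[of u v w x y] yq e by auto
  have no6: "\<not> (adj v (p + 6) \<and> p + 6 \<le> q)"
    using pentagon(9-11)[of w v x y "p + 6"] no_run_of_3[of v w x y "p + 6"] e by auto
  have "outside p v u \<subseteq> outside p q u \<union> {w} \<union> (if adj u x then {x} else {})"
  proof
    fix z assume z: "z \<in> outside p v u"
    then have "z = w \<or> z = x \<or> z = y" if "v < z" "z \<le> q"
      using inner[of u z] that e by (auto simp: outside_def)
    then show "z \<in> outside p q u \<union> {w} \<union> (if adj u x then {x} else {})"
      using z no5 by (cases "z \<le> q") (auto simp: outside_def)
  qed
  then have "out p v u \<le> card (outside p q u \<union> {w} \<union> (if adj u x then {x} else {}))"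
    by (intro card_mono) (auto simp: finite_outside)
  also have "\<dots> \<le> out p q u + 1 + ad u x"
    by (intro order_trans[OF card_Un_le] add_mono) auto
  finally have l1: "deg u \<le> out p q u + 1 + ad u x"
    using e by (simp add: deg_def)
  have "outside u w v \<subseteq> outside p q v \<union> {p, x} \<union> (if adj v y then {y} else {})"
  proof
    fix z assume z: "z \<in> outside u w v"
    then have "z = x \<or> z = y \<or> z = p + 6" if "w < z" "z \<le> q"
      using inner[of v z] that e by (auto simp: outside_def)
    then show "z \<in> outside p q v \<union> {p, x} \<union> (if adj v y then {y} else {})"
      using z no6 e by (cases "z \<le> q") (auto simp: outside_def)
  qed
  then have "out u w v \<le> card (outside p q v \<union> {p, x} \<union> (if adj v y then {y} else {}))"
    by (intro card_mono) (auto simp: finite_outside)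
  also have "\<dots> \<le> out p q v + 2 + ad v y"
    by (intro order_trans[OF card_Un_le] add_mono) (auto simp: card_insert_if)
  finally have l2: "deg v \<le> out p q v + 2 + ad v y"
    using e by (simp add: deg_def eval_nat_numeral)
  have d: "2 \<le> deg u" "deg u \<le> 4" "2 \<le> deg v" "deg v \<le> 4" "deg w \<le> 4"
    using inner_short(2,3)[of p u v] inner_short(2,3)[of u v w] inner_short(3)[of v w x] yq e
    by auto
  have a: "adj p v" "adj u w"
    using inner_short(1)[of p u v] inner_short(1)[of u v w] yq e by auto
  have c1: "if deg u \<le> 3 \<and> deg v \<le> 3 then adj p w else \<not> adj p w \<and> 7 \<le> deg u + deg v"
    using inner_chord_3[of p u v w] yq e by simp
  have c2: "if deg v \<le> 3 \<and> deg w \<le> 3 then adj u x else \<not> adj u x \<and> 7 \<le> deg v + deg w"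
    using inner_chord_3[of u v w x] yq e by simp
  have c3: "if deg w \<le> 3 \<and> deg x \<le> 3 then adj v y else \<not> adj v y \<and> 7 \<le> deg w + deg x"
    using inner_chord_3[of v w x y] yq e by simp
  have r: "\<not> (deg u \<le> 3 \<and> deg v \<le> 3 \<and> deg w \<le> 3)" "\<not> (deg v \<le> 3 \<and> deg w \<le> 3 \<and> deg x \<le> 3)"
    using no_run_of_3[of p u v w x] no_run_of_3[of u v w x y] yq e by auto
  \<comment> \<open>\<open>uw\<close> is crossed by the three diagonals at \<open>v\<close> and
    \<open>uz\<close> by \<open>pv\<close>, \<open>pw\<close> and \<open>pq\<close>, six in
    all.\<close>
  have two: False if 2: "deg u = 2" and 3: "deg v = 3" and h: "adj p w" "1 \<le> out p q u"
  proof -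
    obtain z where "z \<in> outside p q u" using h(2) by fastforce
    then have z: "adj u z" "z < p \<or> q < z" by (auto simp: outside_def)
    have "card {(p, v), (p, w), (p, q)} \<le> edge_cut u z"
      using z pq a h(1) e by (intro edge_cut_ge[of _ _ p q]) (auto simp: adj_E)
    moreover have "distinct [(p, v), (p, w), (p, q)]" using e yq by auto
    then have "card {(p, v), (p, w), (p, q)} = 3" using distinct_card by fastforce
    moreover have "edge_cut u w = 3" using 3 cut_2[of v u w] e by (simp add: edge_cut_def)
    moreover have "edge_cut u z + edge_cut u w \<le> 5"
      using 2 z a yq q_less e by (intro degree_two[of u p v]) auto
    ultimately show False by simp
  qed
  have "3 \<le> out p q u + out p q v"
  proof (cases "deg u \<le> 3 \<and> deg v \<le> 3")
    case True
    then have "adj p w" "\<not> deg w \<le> 3" using c1 r by (auto split: if_splits)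
    then have no: "\<not> adj u x" "\<not> adj v y" "7 \<le> deg v + deg w"
      using c2 c3 by (auto split: if_splits)
    then have v3: "deg v = 3" using True d by linarith
    have l: "1 \<le> out p q u" "1 \<le> out p q v" "deg u \<le> out p q u + 1"
      using l1 l2 no d v3 by simp_all
    have "deg u \<noteq> 2" using two[OF _ v3 \<open>adj p w\<close> l(1)] by blast
    then show ?thesis using l d by linarith
  next
    case False
    then have "7 \<le> deg u + deg v" using c1 by (auto split: if_splits)
    moreover have "\<not> adj u x \<or> \<not> adj v y" using c2 c3 r by (auto split: if_splits)
    then have "ad u x + ad v y \<le> 1" by auto
    ultimately show ?thesis using l1 l2 by linarith
  qed
  then show ?thesis by (simp add: e)
qed

text \<open>Mirror image of \<open>left_end\<close>. Offsets from \<open>y = q - 5\<close> avoid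
  natural subtraction; \<open>no6\<close> takes any \<open>z\<close> with \<open>y = z + 1\<close>
  because \<open>y\<close> may be 0.\<close>

lemma right_end: "3 \<le> out p q (q - 1) + out p q (q - 2)"
proof -
  define u v w x y where "u = q - 1" "v = q - 2" "w = q - 3" "x = q - 4" "y = q - 5"
  note e' = this
  have e: "q = y + 5" "u = y + 4" "v = y + 3" "w = y + 2" "x = y + 1" "p \<le> y"
    using e' pq by auto
  have no5: "\<not> adj y u"
    using pentagon(9-11)[of x y w v u] no_run_of_3[of y x w v u] e by auto
  have no6: "\<not> (adj z v \<and> p \<le> z \<and> y = z + 1)" for z
    using pentagon(9-11)[of y z x w v] no_run_of_3[of z y x w v] e by auto
  have "outside v q u \<subseteq> outside p q u \<union> {w} \<union> (if adj x u then {x} else {})"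
  proof
    fix z assume z: "z \<in> outside v q u"
    then have zu: "adj z u" using adj_sym by (auto simp: outside_def)
    have "z = w \<or> z = x \<or> z = y" if "p \<le> z" "z < v"
      using inner[of z u] that e zu by auto
    then show "z \<in> outside p q u \<union> {w} \<union> (if adj x u then {x} else {})"
      using z no5 zu by (cases "p \<le> z") (auto simp: outside_def)
  qed
  then have "out v q u \<le> card (outside p q u \<union> {w} \<union> (if adj x u then {x} else {}))"
    by (intro card_mono) (auto simp: finite_outside)
  also have "\<dots> \<le> out p q u + 1 + ad x u"
    by (intro order_trans[OF card_Un_le] add_mono) auto
  finally have l1: "deg u \<le> out p q u + 1 + ad x u"
    using e by (simp add: deg_def eval_nat_numeral)
  have "outside w u v \<subseteq> outside p q v \<union> {q, x} \<union> (if adj y v then {y} else {})"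
  proof
    fix z assume z: "z \<in> outside w u v"
    then have zv: "adj z v" using adj_sym by (auto simp: outside_def)
    have "z = x \<or> z = y \<or> y = z + 1" if "p \<le> z" "z < w"
      using inner[of z v] that e zv by auto
    then show "z \<in> outside p q v \<union> {q, x} \<union> (if adj y v then {y} else {})"
      using z no6[of z] e zv by (cases "p \<le> z") (auto simp: outside_def)
  qed
  then have "out w u v \<le> card (outside p q v \<union> {q, x} \<union> (if adj y v then {y} else {}))"
    by (intro card_mono) (auto simp: finite_outside)
  also have "\<dots> \<le> out p q v + 2 + ad y v"
    by (intro order_trans[OF card_Un_le] add_mono) (auto simp: card_insert_if)
  finally have l2: "deg v \<le> out p q v + 2 + ad y v"
    using e by (simp add: deg_def eval_nat_numeral)
  have d: "2 \<le> deg u" "deg u \<le> 4" "2 \<le> deg v" "deg v \<le> 4" "deg w \<le> 4"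
    using inner_short(2,3)[of v u q] inner_short(2,3)[of w v u] inner_short(3)[of x w v] e
    by auto
  have a: "adj v q" "adj w u"
    using inner_short(1)[of v u q] inner_short(1)[of w v u] e by auto
  have c1: "if deg v \<le> 3 \<and> deg u \<le> 3 then adj w q else \<not> adj w q \<and> 7 \<le> deg v + deg u"
    using inner_chord_3[of w v u q] e by simp
  have c2: "if deg w \<le> 3 \<and> deg v \<le> 3 then adj x u else \<not> adj x u \<and> 7 \<le> deg w + deg v"
    using inner_chord_3[of x w v u] e by simp
  have c3: "if deg x \<le> 3 \<and> deg w \<le> 3 then adj y v else \<not> adj y v \<and> 7 \<le> deg x + deg w"
    using inner_chord_3[of y x w v] e by simp
  have r: "\<not> (deg w \<le> 3 \<and> deg v \<le> 3 \<and> deg u \<le> 3)" "\<not> (deg x \<le> 3 \<and> deg w \<le> 3 \<and> deg v \<le> 3)"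
    using no_run_of_3[of x w v u q] no_run_of_3[of y x w v u] e by auto
  have two: False if 2: "deg u = 2" and 3: "deg v = 3" and h: "adj w q" "1 \<le> out p q u"
  proof -
    obtain z where "z \<in> outside p q u" using h(2) by fastforce
    then have z: "adj u z" "z < p \<or> q < z" by (auto simp: outside_def)
    have "card {(v, q), (w, q), (p, q)} \<le> edge_cut u z"
      using z pq a h(1) e by (intro edge_cut_ge[of _ _ p q]) (auto simp: adj_E)
    moreover have "distinct [(v, q), (w, q), (p, q)]" using e by auto
    then have "card {(v, q), (w, q), (p, q)} = 3" using distinct_card by fastforce
    moreover have "edge_cut u w = 3" using 3 cut_2[of v w u] e by (simp add: edge_cut_def)
    moreover have "edge_cut u z + edge_cut u w \<le> 5"
      using 2 z a(2)[unfolded adj_sym[of w]] q_less e by (intro degree_two[of u v q]) auto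
    ultimately show False by simp
  qed
  have "3 \<le> out p q u + out p q v"
  proof (cases "deg u \<le> 3 \<and> deg v \<le> 3")
    case True
    then have "adj w q" "\<not> deg w \<le> 3" using c1 r by (auto split: if_splits)
    then have no: "\<not> adj x u" "\<not> adj y v" "7 \<le> deg v + deg w"
      using c2 c3 by (auto split: if_splits)
    then have v3: "deg v = 3" using True d by linarith
    have l: "1 \<le> out p q u" "1 \<le> out p q v" "deg u \<le> out p q u + 1"
      using l1 l2 no d v3 by simp_all
    have "deg u \<noteq> 2" using two[OF _ v3 \<open>adj w q\<close> l(1)] by blast
    then show ?thesis using l d by linarith
  next
    case False
    then have "7 \<le> deg u + deg v" using c1 by (auto split: if_splits)
    moreover have "\<not> adj x u \<or> \<not> adj y v" using c2 c3 r by (auto split: if_splits)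
    then have "ad x u + ad y v \<le> 1" by auto
    ultimately show ?thesis using l1 l2 by linarith
  qed
  then show ?thesis by (simp add: e')
qed

lemma contradiction: False
proof -
  have "6 \<le> out p q (p + 1) + out p q (p + 2) + out p q (q - 2) + out p q (q - 1)"
    using left_end right_end by simp
  also have "\<dots> = (\<Sum>v\<in>{p + 1, p + 2, q - 2, q - 1}. out p q v)"
  proof -
    have "distinct [p + 1, p + 2, q - 2, q - 1]" using pq by auto
    then show ?thesis using sum.distinct_set_conv_list[of _ "out p q"] by fastforce
  qed
  also have "\<dots> \<le> (\<Sum>v\<in>{p<..<q}. out p q v)"
    using pq by (intro sum_mono2) auto
  finally show False using cut_pq by simp
qed

end

context minimal_counterexample
begin

text \<open>The side \<open>(0, n - 1)\<close> is uncrossed, hence an edge, and cuts off at least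
  four vertices. So a shortest such edge exists, and any other edge within its span is
  shorter.\<close>

lemma contradiction: False
proof -
  define long where "long d \<longleftrightarrow> (\<exists>p. adj p (p + d) \<and> 5 \<le> d)" for d
  have "cut 0 (n - 1) = 0"
  proof -
    have "crossed_by (0, n - 1) E = {}"
      by (auto simp: crossed_by_def crosses_def dest: E_less)
    then show ?thesis by simp
  qed
  then have "adj 0 (0 + (n - 1))"
    using cut_adj[of 0 "n - 1"] n_ge by (auto split: if_splits)
  moreover have "5 \<le> n - 1" using n_ge by simp
  ultimately have ex: "long (n - 1)" unfolding long_def by blast
  define d where "d = (LEAST d. long d)"
  have "long d" using ex unfolding d_def by (rule LeastI)
  then obtain p where p: "adj p (p + d)" "5 \<le> d" by (auto simp: long_def)
  have least: "\<not> long d'" if "d' < d" for d'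
    using that unfolding d_def by (rule not_less_Least)
  interpret minimal_chord n E p "p + d"
  proof
    fix i j assume ij: "adj i j" "p \<le> i" "i < j" "j \<le> p + d" "(i, j) \<noteq> (p, p + d)"
    then have "j - i < d" by auto
    then have "\<not> long (j - i)" by (rule least)
    moreover have "adj i (i + (j - i))" using ij by simp
    ultimately have "\<not> 5 \<le> j - i" unfolding long_def by blast
    then show "j \<le> i + 4" by simp
  qed (use p in auto)
  show False by (rule contradiction)
qed

end

section \<open>The linear crossing bound\<close>

lemma crossing_bound_if_few_chords:
  assumes "finite V" "20 * card (chords V) + 102 \<le> 57 * card V"
  shows "crossing_bound V"
  unfolding crossing_bound_def
proof (intro allI impI)
  fix E assume "E \<subseteq> chords V"
  then have "card E \<le> card (chords V)"
    using assms(1) by (intro card_mono finite_chords)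
  then show "20 * card E + 102 \<le> 57 * card V + 4 * card (crossings E)"
    using assms(2) by linarith
qed

lemma crossing_bound_lessThan:
  fixes n :: nat
  assumes "3 \<le> n"
  shows "crossing_bound {..<n}"
  using assms
proof (induction n rule: less_induct)
  case (less n)
  consider "n = 3" | "n = 4" | "n = 5" | "6 \<le> n" using less.prems by linarith
  then show ?case
  proof cases
    case 4
    show ?thesis
    proof (rule ccontr)
      assume "\<not> ?thesis"
      then obtain E0 where E0: "E0 \<subseteq> chords {..<n}"
        "57 * n + 4 * card (crossings E0) < 20 * card E0 + 102"
        unfolding crossing_bound_def by (auto simp: not_le)
      define A where "A = Pow (chords {..<n})"
      define \<phi> :: "(nat \<times> nat) set \<Rightarrow> int"
        where "\<phi> E = 20 * int (card E) - 4 * int (card (crossings E))" for E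
      have A: "finite A" "E0 \<in> A" using E0 by (auto simp: A_def finite_chords)
      define m where "m = Max (\<phi> ` A)"
      have "m \<in> \<phi> ` A" unfolding m_def using A by (intro Max_in) auto
      then obtain E1 where "E1 \<in> A \<and> \<phi> E1 = m" by auto
      then obtain E where E: "E \<in> A" "\<phi> E = m"
        and min: "\<And>F. F \<in> A \<Longrightarrow> \<phi> F = m \<Longrightarrow> card E \<le> card F"
        using ex_has_least_nat[of "\<lambda>E. E \<in> A \<and> \<phi> E = m" E1 card] by blast
      have max: "\<phi> F \<le> \<phi> E" if "F \<in> A" for F
        unfolding E(2) m_def using that A by (intro Max_ge) auto
      have fin: "finite E" using E A_def finite_chords finite_subset by blast
      have "minimal_counterexample n E"
      proof (rule minimal_counterexample.intro)
        show "6 \<le> n" by fact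
        show "E \<subseteq> chords {..<n}" using E(1) by (simp add: A_def)
        show "crossing_bound V" if "finite V" "3 \<le> card V" "card V < n" for V :: "nat set"
          by (rule crossing_bound_transfer[OF less.IH]) (use that in auto)
        show "57 * n + 4 * card (crossings E) < 20 * card E + 102"
          using max[OF A(2)] E0(2) by (simp add: \<phi>_def)
      next
        fix e assume e: "e \<in> E"
        then have F: "E - {e} \<in> A" using E by (auto simp: A_def)
        have card: "int (card (E - {e})) = int (card E) - 1" "card (E - {e}) < card E"
          using card_Suc_Diff1[OF fin e] by linarith+
        \<comment> \<open>The least size of \<open>E\<close> makes the drop of \<open>\<phi>\<close>
          strict; this gives 4 crossings rather than 5.\<close>
        have "\<phi> (E - {e}) \<noteq> m" using min[OF F] card(2) by linarith
        then have "\<phi> (E - {e}) < \<phi> E" using max[OF F] E(2) by simp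
        then show "card (crossed_by e E) \<le> 4"
          using card_crossings_remove[OF fin e] card by (simp add: \<phi>_def)
      next
        fix e assume e: "e \<in> chords {..<n}" "e \<notin> E"
        then have "insert e E \<in> A" using E by (auto simp: A_def)
        then show "5 \<le> card (crossed_by e E)"
          using max[of "insert e E"] card_crossings_insert[OF fin e(2)] e fin
          by (simp add: \<phi>_def)
      qed
      then show False by (rule minimal_counterexample.contradiction)
    qed
  next
    case 3
    show ?thesis
      unfolding crossing_bound_def
    proof (intro allI impI)
      fix E assume E: "E \<subseteq> chords {..<n}"
      show "20 * card E + 102 \<le> 57 * card {..<n} + 4 * card (crossings E)"
      \<comment> \<open>Only the complete graph, 302 against 285, needs its five crossings; nine
        edges reach just 282.\<close>
      proof (cases "E = chords {..<5}")
        case True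
        then show ?thesis
          using crossings_5 card_chords[of 5] length_chord_list 3 by simp
      next
        case False
        then have "card E < card (chords {..<5::nat})"
          using E 3 by (intro psubset_card_mono finite_chords) auto
        then show ?thesis using card_chords[of 5] length_chord_list 3 by simp
      qed
    qed
  next
    case 1
    then show ?thesis
      using card_chords[of 3] length_chord_list by (intro crossing_bound_if_few_chords) simp_all
  next
    case 2
    then show ?thesis
      using card_chords[of 4] length_chord_list by (intro crossing_bound_if_few_chords) simp_all
  qed
qed

lemma crossing_bound:
  fixes V :: "'a::linorder set"
  assumes "finite V" "3 \<le> card V"
  shows "crossing_bound V"
  by (rule crossing_bound_transfer[OF crossing_bound_lessThan]) (use assms in auto)

section \<open>Colourings of the complete convex graph\<close>

definition monochromatic :: "('a::linorder \<times> 'a \<Rightarrow> nat) \<Rightarrow> 'a set \<Rightarrow> (('a \<times> 'a) \<times> ('a \<times> 'a)) set" where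
  "monochromatic c V = {(e, f) \<in> crossings (chords V). c e = c f}"

lemma finite_monochromatic: "finite V \<Longrightarrow> finite (monochromatic c V)"
  by (rule finite_subset[of _ "crossings (chords V)"])
    (auto simp: monochromatic_def finite_crossings finite_chords)

lemma card_chords_choose: "finite V \<Longrightarrow> card (chords V) = card V choose 2"
proof -
  assume "finite V"
  have "bij_betw (\<lambda>(a, b). {a, b}) (chords V) {A. A \<subseteq> V \<and> card A = 2}"
    unfolding bij_betw_def
  proof
    show "inj_on (\<lambda>(a, b). {a, b}) (chords V)"
      by (auto simp: inj_on_def chords_def doubleton_eq_iff)
    have "A \<in> (\<lambda>(a, b). {a, b}) ` chords V" if A: "A \<subseteq> V" "card A = 2" for A
    proof -
      obtain x y where xy: "A = {x, y}" "x \<noteq> y" using A(2) unfolding card_2_iff by blast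
      then consider "x < y" | "y < x" using linorder_neqE by blast
      then show ?thesis
        using xy A by cases (auto simp: chords_def image_iff)
    qed
    then show "(\<lambda>(a, b). {a, b}) ` chords V = {A. A \<subseteq> V \<and> card A = 2}"
      by (auto simp: chords_def card_insert_if)
  qed
  then show ?thesis
    using n_subsets[OF \<open>finite V\<close>, of 2] by (simp add: bij_betw_same_card)
qed

text \<open>The sides join successive vertices, and the least to the greatest; a third vertex keeps
  the latter pair from being successive.\<close>

lemma exists_polygon_sides:
  fixes V :: "'a::linorder set"
  assumes "finite V" "3 \<le> card V"
  obtains U where "U \<subseteq> chords V" "card U = card V" "\<And>e. e \<in> U \<Longrightarrow> crossed_by e (chords V) = {}"
proof -
  define m M where "m = Min V" and "M = Max V"
  define nxt where "nxt v = Min {w \<in> V. v < w}" for v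
  have V: "V \<noteq> {}" using assms by auto
  have mM: "m \<in> V" "M \<in> V" and bounds: "\<And>v. v \<in> V \<Longrightarrow> m \<le> v \<and> v \<le> M"
    using assms(1) V by (auto simp: m_def M_def)
  have nxt: "nxt v \<in> V" "v < nxt v" "\<And>w. w \<in> V \<Longrightarrow> v < w \<Longrightarrow> nxt v \<le> w"
    if "v \<in> V - {M}" for v
  proof -
    have "M \<in> {w \<in> V. v < w}" using that bounds[of v] mM by auto
    then have "nxt v \<in> {w \<in> V. v < w}"
      unfolding nxt_def using assms(1) by (intro Min_in) auto
    then show "nxt v \<in> V" "v < nxt v" by auto
    show "nxt v \<le> w" if "w \<in> V" "v < w" for w
      unfolding nxt_def using that assms(1) by (intro Min_le) auto
  qed
  have "\<not> V \<subseteq> {m, M}"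
  proof
    assume "V \<subseteq> {m, M}"
    then have "card V \<le> card {m, M}" by (intro card_mono) auto
    also have "\<dots> \<le> 2" by (simp add: card_insert_if)
    finally show False using assms by simp
  qed
  then obtain z where z: "z \<in> V" "m < z" "z < M"
    using bounds by (metis insert_iff order_le_imp_less_or_eq subsetI)
  define U where "U = insert (m, M) ((\<lambda>v. (v, nxt v)) ` (V - {M}))"
  show ?thesis
  proof (rule that)
    show "U \<subseteq> chords V"
      using nxt mM z by (auto simp: U_def chords_def)
    have "(m, M) \<notin> (\<lambda>v. (v, nxt v)) ` (V - {M})"
      using nxt(3)[of m z] mM z by fastforce
    then have "card U = Suc (card (V - {M}))"
      using assms(1) by (simp add: U_def card_image inj_on_def)
    then show "card U = card V"
      using card_Suc_Diff1[OF assms(1) mM(2)] by simp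
    show "crossed_by e (chords V) = {}" if "e \<in> U" for e
    proof -
      have "\<not> crosses e (a, b) \<and> \<not> crosses (a, b) e" if ab: "a \<in> V" "b \<in> V" for a b
      proof (cases "e = (m, M)")
        case True
        then show ?thesis using bounds[OF ab(1)] bounds[OF ab(2)] by (auto simp: crosses_def)
      next
        case False
        then obtain v where v: "v \<in> V - {M}" "e = (v, nxt v)" using \<open>e \<in> U\<close> by (auto simp: U_def)
        then show ?thesis using nxt(3)[OF v(1) ab(1)] nxt(3)[OF v(1) ab(2)]
          by (auto simp: crosses_def)
      qed
      then show ?thesis by (auto simp: crossed_by_def chords_def)
    qed
  qed
qed

text \<open>With all sides added, a page with d diagonals satisfies 20 d \<le> 37 N - 102 + 4 cr for
  N = \<open>card V\<close>, where 37 = 57 - 20. There are N (N - 3) / 2 diagonals in all.\<close>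

lemma monochromatic_ge:
  fixes V :: "'a::linorder set"
  assumes V: "finite V" "3 \<le> card V" and "0 < k"
    and c: "\<And>e. e \<in> chords V \<Longrightarrow> c e < k"
  shows "10 * real (card V) * (real (card V) - 3) - real k * (37 * real (card V) - 102)
    \<le> 4 * real (card (monochromatic c V))"
proof -
  obtain U where U: "U \<subseteq> chords V" "card U = card V" "\<And>e. e \<in> U \<Longrightarrow> crossed_by e (chords V) = {}"
    using exists_polygon_sides[OF V] by blast
  define P where "P i = {e \<in> chords V. c e = i}" for i
  have fin: "finite (chords V)" by (rule finite_chords[OF V(1)])
  then have fin: "finite (chords V)" "finite U" "finite (P i)" for i
    using finite_subset[OF U(1)] by (simp_all add: P_def)
  have not_U: "e \<notin> U" "f \<notin> U" if "e \<in> chords V" "f \<in> chords V" "crosses e f" for e f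
  proof -
    have "f \<in> crossed_by e (chords V)" "e \<in> crossed_by f (chords V)"
      using that by (simp_all add: crossed_by_def)
    then show "e \<notin> U" "f \<notin> U" using U(3) by blast+
  qed
  have "crossings (P i \<union> U) = crossings (P i)" for i
  proof (rule equalityI[OF subsetI])
    fix x assume "x \<in> crossings (P i \<union> U)"
    then have x: "fst x \<in> P i \<union> U" "snd x \<in> P i \<union> U" "crosses (fst x) (snd x)"
      by (simp_all add: crossings_def case_prod_beta)
    then have "fst x \<in> chords V" "snd x \<in> chords V"
      using U(1) by (auto simp: P_def)
    then show "x \<in> crossings (P i)"
      using x not_U by (simp add: crossings_def case_prod_beta)
  qed (auto intro: crossings_mono[THEN subsetD, rotated])
  then have page: "20 * card (P i \<union> U) + 102 \<le> 57 * card V + 4 * card (crossings (P i))" for i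
    using crossing_bound[OF V] U(1) unfolding crossing_bound_def P_def
    by (metis (no_types, lifting) Un_least mem_Collect_eq subsetI)
  have "(\<Sum>i<k. card (crossings (P i))) = card (\<Union>i<k. crossings (P i))"
    by (intro card_UN_disjoint[symmetric] ballI impI finite_crossings fin)
      (auto simp: crossings_def P_def)
  also have "(\<Union>i<k. crossings (P i)) = monochromatic c V"
    using c by (auto simp: monochromatic_def crossings_def P_def)
  finally have mono: "(\<Sum>i<k. card (crossings (P i))) = card (monochromatic c V)" .
  have "(\<Sum>i<k. card (P i - U)) = card (\<Union>i<k. P i - U)"
    using fin by (intro card_UN_disjoint[symmetric]) (auto simp: P_def)
  also have "(\<Union>i<k. P i - U) = chords V - U"
    using c by (auto simp: P_def)
  also have "card \<dots> = (card V choose 2) - card V"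
    using card_Diff_subset[OF fin(2) U(1)] card_chords_choose[OF V(1)] U(2) by simp
  finally have "(\<Sum>i<k. card (P i - U)) = (card V choose 2) - card V" .
  moreover have "card V \<le> card V choose 2"
    using card_mono[OF fin(1) U(1)] card_chords_choose[OF V(1)] U(2) by simp
  ultimately have E: "(\<Sum>i<k. card (P i - U)) + card V = card V choose 2" by simp
  have "card (P i \<union> U) = card (P i - U) + card V" for i
  proof -
    have "P i \<union> U = (P i - U) \<union> U" by auto
    then show ?thesis using fin U(2) by (metis Diff_disjoint card_Un_disjoint finite_Diff inf_commute)
  qed
  then have "(\<Sum>i<k. 20 * (card (P i - U) + card V) + 102) \<le> (\<Sum>i<k. 57 * card V + 4 * card (crossings (P i)))"
    using page by (intro sum_mono) simp
  then have "20 * (\<Sum>i<k. card (P i - U)) + k * (20 * card V + 102)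
      \<le> k * (57 * card V) + 4 * card (monochromatic c V)"
    by (simp add: sum.distrib sum_distrib_left[symmetric] mono distrib_left)
  then have "20 * real (\<Sum>i<k. card (P i - U)) + real k * (20 * real (card V) + 102)
      \<le> real k * (57 * real (card V)) + 4 * real (card (monochromatic c V))"
    by (metis (mono_tags, lifting) of_nat_add of_nat_mult of_nat_numeral of_nat_le_iff)
  moreover have "2 * (real (\<Sum>i<k. card (P i - U)) + real (card V)) = real (card V) * (real (card V) - 1)"
  proof -
    have "real (card V choose 2) = real (card V) * (real (card V) - 1) / 2"
      using V(2) by (simp add: choose_two real_of_nat_div of_nat_diff)
    then show ?thesis using E by (metis (mono_tags, lifting) nonzero_mult_div_cancel_left of_nat_add times_divide_eq_right zero_neq_numeral)
  qed
  ultimately show ?thesis by (simp add: algebra_simps)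
qed

text \<open>Double counting: a crossing survives the removal of \<open>v\<close> unless
  \<open>v\<close> is one of its four distinct ends.\<close>

lemma sum_monochromatic_remove:
  fixes V :: "'a::linorder set"
  assumes "finite V"
  shows "(\<Sum>v\<in>V. card (monochromatic c (V - {v}))) = (card V - 4) * card (monochromatic c V)"
proof -
  define vs :: "('a \<times> 'a) \<times> ('a \<times> 'a) \<Rightarrow> 'a set"
    where "vs x = {fst (fst x), snd (fst x), fst (snd x), snd (snd x)}" for x
  have "monochromatic c (V - {v}) = {x \<in> monochromatic c V. v \<notin> vs x}" for v
    by (auto simp: monochromatic_def crossings_def chords_def vs_def)
  then have "(\<Sum>v\<in>V. card (monochromatic c (V - {v})))
      = (\<Sum>v\<in>V. card {x \<in> monochromatic c V. v \<notin> vs x})" by simp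
  also have "\<dots> = (card V - 4) * card (monochromatic c V)"
  proof (rule sum_multicount[OF assms finite_monochromatic[OF assms]], intro ballI)
    fix x assume x: "x \<in> monochromatic c V"
    obtain a b a' b' where x': "x = ((a, b), (a', b'))" by (metis surj_pair)
    have "a < a'" "a' < b" "b < b'" and V: "vs x \<subseteq> V"
      using x by (auto simp: x' monochromatic_def crossings_def chords_def crosses_def vs_def)
    then have "distinct [a, b, a', b']" by auto
    from distinct_card[OF this] have "card (vs x) = 4" by (simp add: vs_def x')
    note \<open>card (vs x) = 4\<close> V
    moreover have "{v \<in> V. v \<notin> vs x} = V - vs x" by auto
    ultimately show "card {v \<in> V. v \<notin> vs x} = card V - 4"
      by (simp add: card_Diff_subset vs_def)
  qed
  finally show ?thesis .
qed

text \<open>Averaging over the deletion of one vertex preserves the ratio, since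
  \<open>(n + 1) * (n choose 4) = (n - 3) * (n + 1 choose 4)\<close>. The bound thus climbs from
  \<open>N\<close> one vertex at a time.\<close>

lemma monochromatic_ratio:
  fixes V :: "'a::linorder set"
  assumes "4 \<le> N" "N \<le> card V" "finite V"
    and base: "\<And>W. W \<subseteq> V \<Longrightarrow> card W = N \<Longrightarrow> R * real (N choose 4) \<le> real (card (monochromatic c W))"
  shows "R * real (card V choose 4) \<le> real (card (monochromatic c V))"
  using assms(2-4)
proof (induction "card V" arbitrary: V)
  case 0
  then show ?case using assms(1) by simp
next
  case (Suc n)
  show ?case
  proof (cases "N = Suc n")
    case True
    then show ?thesis using Suc.prems(3)[of V] Suc.hyps(2) by simp
  next
    case False
    then have n: "N \<le> n" using Suc by simp
    have "R * real (n choose 4) \<le> real (card (monochromatic c (V - {v})))" if "v \<in> V" for v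
    proof -
      have eq: "n = card (V - {v})"
        using Suc.hyps(2) Suc.prems(2) that by (simp add: card_Diff_singleton flip: Suc.hyps(2))
      have "R * real (card (V - {v}) choose 4) \<le> real (card (monochromatic c (V - {v})))"
        by (rule Suc.hyps(1)[OF eq]) (use n eq Suc.prems(2,3) in auto)
      then show ?thesis using eq by simp
    qed
    then have "real (card V) * (R * real (n choose 4)) \<le> (\<Sum>v\<in>V. real (card (monochromatic c (V - {v}))))"
      by (intro sum_bounded_below)
    also have "\<dots> = real ((card V - 4) * card (monochromatic c V))"
      using sum_monochromatic_remove[OF Suc.prems(2), of c] by (metis of_nat_sum)
    also have "\<dots> = real (card V - 4) * real (card (monochromatic c V))" by simp
    finally have "R * real (card V * (n choose 4)) \<le> real (card V - 4) * real (card (monochromatic c V))"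
      by (simp add: mult_ac)
    also have "card V * (n choose 4) = (card V - 4) * (card V choose 4)"
      using binomial_absorb_comp[of "card V" 4] Suc.hyps(2) by (metis diff_Suc_1)
    finally have "real (card V - 4) * (R * real (card V choose 4)) \<le> real (card V - 4) * real (card (monochromatic c V))"
      by (simp add: mult_ac)
    moreover have "0 < real (card V - 4)" using n assms(1) Suc.hyps(2) by simp
    ultimately show ?thesis by simp
  qed
qed

lemma real_choose_4:
  assumes "4 \<le> n"
  shows "real (n choose 4) = real n * (real n - 1) * (real n - 2) * (real n - 3) / 24"
  using assms by (simp add: binomial_gbinomial gbinomial_prod_rev eval_nat_numeral fact_numeral algebra_simps)

text \<open>
  After clearing denominators, the difference of the two sides is a polynomial in \<open>k - 3\<close> whose
  coefficients are the polynomials \<open>c0\<close> to \<open>c4\<close> in \<open>19 - r\<close> and a positive constant.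
\<close>

lemma page_count_inequality:
  fixes k r N :: real
  assumes N: "20 * N = 111 * k - r" and r: "0 \<le> r" "r \<le> 19" and k: "3 \<le> k"
  shows "4 * (8000 * (4107 * k ^ 2 - 5416 * k + 1309) /
           (37 * (111 * k - 17) * (111 * k - 77) * (37 * k - 19) * (3 * k - 1)))
           * (N * (N - 1) * (N - 2) * (N - 3) / 24)
         \<le> 10 * N * (N - 3) - k * (37 * N - 102)"
proof -
  define a s M where "a = k - 3" and "s = 19 - r" and "M = 20 * N"
  have as: "0 \<le> a" "0 \<le> s" "s \<le> 19" using r k by (auto simp: a_def s_def)
  have ka: "k = a + 3" and M: "M = 111 * a + 314 + s" and N': "N = M / 20"
    using N by (auto simp: a_def s_def M_def)
  \<comment> \<open>For \<open>r = 17\<close> the product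
    \<open>M * (M - 20) * (M - 40) * (M - 60)\<close> is \<open>3 * D\<close>: this explains the
    linear factors of the stated coefficient. The difference expanded below is then
    \<open>960 * k * D\<close>.\<close>
  define D where "D = 37 * (111 * k - 17) * (111 * k - 77) * (37 * k - 19) * (3 * k - 1)"
  define Q where "Q = 4107 * k ^ 2 - 5416 * k + 1309"
  define c0 where "c0 = 5798377705344 + 281228221952 * s - 4027302848 * s ^ 2 - 25019264 * s ^ 3 - 22024 * s ^ 4"
  define c1 where "c1 = 11178477720672 + 438074418688 * s - 7293051184 * s ^ 2 - 31619392 * s ^ 3 - 19226 * s ^ 4"
  define c2 where "c2 = 8604544643088 + 255781565952 * s - 4849999368 * s ^ 2 - 13201896 * s ^ 3 - 4107 * s ^ 4"
  define c3 where "c3 = 3305991025008 + 66350852064 * s - 1410360228 * s ^ 2 - 1823508 * s ^ 3"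
  define c4 where "c4 = 634099377888 + 6452483058 * s - 151807041 * s ^ 2"
  \<comment> \<open>Replacing the higher powers, which occur with negative signs, by multiples of
    \<open>s\<close> makes the signs of \<open>c0\<close> to \<open>c4\<close> a linear
    question.\<close>
  have s2: "s ^ 2 \<le> 19 * s"
    using as by (simp add: power2_eq_square mult_right_mono)
  have s3: "s ^ 3 \<le> 361 * s"
    using mult_left_mono[OF s2 as(2)] s2 by (simp add: power2_eq_square power3_eq_cube)
  have s4: "s ^ 4 \<le> 6859 * s"
    using mult_left_mono[OF s3 as(2)] s2 by (simp add: power2_eq_square eval_nat_numeral mult_ac)
  have c: "0 \<le> c0" "0 \<le> c1" "0 \<le> c2" "0 \<le> c3" "0 \<le> c4"
    unfolding c0_def c1_def c2_def c3_def c4_def using s2 s3 s4 as by linarith+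
  \<comment> \<open>The coefficient of \<open>a ^ 5\<close> is free of \<open>s\<close> because
    \<open>111 / 20\<close> is the critical point of the leading term.\<close>
  have "3 * D * (M * (M - 60) - 2 * k * (37 * M - 2040)) - Q * (M * (M - 20) * (M - 40) * (M - 60))
      = c0 + c1 * a + c2 * a ^ 2 + c3 * a ^ 3 + c4 * a ^ 4 + 48578253120 * a ^ 5"
    unfolding D_def Q_def ka M c0_def c1_def c2_def c3_def c4_def by algebra
  also have "0 \<le> \<dots>"
    using c as by (intro add_nonneg_nonneg mult_nonneg_nonneg zero_le_power) auto
  finally have main: "Q * (M * (M - 20) * (M - 40) * (M - 60))
      \<le> 3 * D * (M * (M - 60) - 2 * k * (37 * M - 2040))" by simp
  have "0 < D" unfolding D_def using k by (intro mult_pos_pos) auto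
  have "4 * (8000 * Q / D) * (N * (N - 1) * (N - 2) * (N - 3) / 24)
      = Q * (M * (M - 20) * (M - 40) * (M - 60)) / (120 * D)"
  proof -
    have "N * (N - 1) * (N - 2) * (N - 3) = M * (M - 20) * (M - 40) * (M - 60) / 160000"
      unfolding N' by (simp add: field_simps)
    then show ?thesis by (simp only:) simp
  qed
  also have "\<dots> \<le> 3 * D * (M * (M - 60) - 2 * k * (37 * M - 2040)) / (120 * D)"
    using main \<open>0 < D\<close> by (intro divide_right_mono) auto
  also have "\<dots> = 10 * N * (N - 3) - k * (37 * N - 102)"
    unfolding N' using \<open>0 < D\<close> by (simp add: field_simps)
  finally show ?thesis unfolding D_def Q_def .
qed

section \<open>From drawings to colourings\<close>

text \<open>Rotating the page into the upper halfplane puts both paths into a box with all four ends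
  on its bottom edge, where \<open>fashoda_interlace\<close> applies. The map \<open>\<phi>\<close>
  is injective on the page, so a common image comes from a common point.\<close>

lemma page_paths_meet:
  assumes paths: "path f" "path g"
    and page: "path_image f \<subseteq> book_page k i" "path_image g \<subseteq> book_page k i"
    and ends: "pathstart f = (a, 0)" "pathfinish f = (b, 0)" "pathstart g = (c, 0)" "pathfinish g = (d, 0)"
    and order: "a < c" "c < b" "b < d"
  obtains p where "p \<in> path_image f" "p \<in> path_image g"
proof -
  define \<theta> where "\<theta> = 2 * pi * real i / real k"
  define \<phi> :: "real \<times> complex \<Rightarrow> real^2"
    where "\<phi> p = (\<chi> j. if j = 1 then fst p else Re (snd p * cis (- \<theta>)))" for p
  have \<phi>1: "\<phi> p $ 1 = fst p" and \<phi>2: "\<phi> p $ 2 = Re (snd p * cis (- \<theta>))" for p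
    by (simp_all add: \<phi>_def)
  have cont: "continuous_on S \<phi>" for S
    unfolding \<phi>_def
  proof (intro continuous_on_vec_lambda)
    fix j :: 2
    show "continuous_on S (\<lambda>p. if j = 1 then fst p else Re (snd p * cis (- \<theta>)))"
      by (cases "j = 1") (auto intro!: continuous_intros)
  qed
  have page_\<phi>: "0 \<le> \<phi> p $ 2 \<and> p = (\<phi> p $ 1, of_real (\<phi> p $ 2) * cis \<theta>)" if "p \<in> book_page k i" for p
  proof -
    obtain x r where p: "p = (x, of_real r * cis \<theta>)" "0 \<le> r"
      using \<open>p \<in> book_page k i\<close> unfolding book_page_def \<theta>_def by blast
    have "of_real r * cis \<theta> * cis (- \<theta>) = complex_of_real r"
      by (simp add: mult.assoc cis_mult)
    then have "\<phi> p $ 2 = r" unfolding \<phi>2 p(1) by (simp only: snd_conv Re_complex_of_real)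
    then show ?thesis using p by (simp add: \<phi>1)
  qed
  have "compact (\<phi> ` (path_image f \<union> path_image g))"
    using paths by (intro compact_continuous_image cont compact_Un compact_path_image)
  then obtain M where M: "\<And>p. p \<in> path_image f \<union> path_image g \<Longrightarrow> norm (\<phi> p) \<le> M"
    using bounded_iff compact_imp_bounded by (metis imageI)
  define l u :: "real^2" where "l = (\<chi> j. if j = 1 then - M else 0)" and "u = (\<chi> j. M)"
  have box: "\<phi> p \<in> cbox l u" if "p \<in> path_image f \<union> path_image g" for p
  proof -
    have "\<bar>\<phi> p $ j\<bar> \<le> M" for j
      using component_le_norm_cart[of "\<phi> p" j] M[OF that] by linarith
    moreover have "0 \<le> \<phi> p $ 2" using page_\<phi>[of p] page that by auto
    ultimately show ?thesis
      unfolding mem_box_cart forall_2 by (simp add: l_def u_def abs_le_iff minus_le_iff)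
  qed
  have l2: "l $ 2 = 0" by (simp add: l_def)
  have "path (\<phi> \<circ> f)" "path (\<phi> \<circ> g)"
    using paths cont by (auto intro: path_continuous_image)
  then obtain z where z: "z \<in> path_image (\<phi> \<circ> f)" "z \<in> path_image (\<phi> \<circ> g)"
  proof (rule fashoda_interlace)
    show "path_image (\<phi> \<circ> f) \<subseteq> cbox l u" "path_image (\<phi> \<circ> g) \<subseteq> cbox l u"
      using box by (auto simp: path_image_compose)
  qed (use ends order in \<open>simp_all add: pathstart_compose pathfinish_compose \<phi>1 \<phi>2 l2\<close>)
  then obtain p q where p: "p \<in> path_image f" "z = \<phi> p" and q: "q \<in> path_image g" "z = \<phi> q"
    by (auto simp: path_image_compose)
  then have "p = q"
    using page_\<phi>[of p] page_\<phi>[of q] page by (metis subsetD)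
  then show ?thesis using that p q by blast
qed

lemma oriented_arc:
  assumes "arc g" "{pathstart g, pathfinish g} = {s, t}"
  obtains h where "path h" "path_image h = path_image g" "pathstart h = s" "pathfinish h = t"
proof (cases "pathstart g = s \<and> pathfinish g = t")
  case True
  then show ?thesis using that[of g] assms by (simp add: arc_imp_path)
next
  case False
  then have "pathstart g = t \<and> pathfinish g = s" using assms(2) by (auto simp: doubleton_eq_iff)
  then show ?thesis using that[of "reversepath g"] assms by (simp add: arc_imp_path)
qed

text \<open>The spine coordinates serve as the convex vertex set and the pages as colours. One
  meeting point is chosen for each monochromatic crossing; the pair of edges alone recovers the
  crossing, so the choice is injective.\<close>

lemma edge_crossings_ge_monochromatic:
  assumes drawing: "book_drawing k {..<n} (complete_edges n) pos \<gamma>"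
  obtains V :: "real set" and c where "finite V" "card V = n" "\<And>e. e \<in> chords V \<Longrightarrow> c e < k"
    "card (monochromatic c V) \<le> card (edge_crossings {..<n} (complete_edges n) pos \<gamma>)"
proof -
  define x where "x v = fst (pos v)" for v
  have pos: "pos v = (x v, 0)" if "v < n" for v
    using drawing that by (fastforce simp: book_drawing_def book_spine_def x_def)
  have inj: "inj_on pos {..<n}" using drawing by (simp add: book_drawing_def)
  have inj_x: "inj_on x {..<n}"
    using inj pos by (simp add: inj_on_def)
  have edge: "arc (\<gamma> e)" "{pathstart (\<gamma> e), pathfinish (\<gamma> e)} = pos ` e"
    "path_image (\<gamma> e) \<inter> pos ` {..<n} = pos ` e" "\<exists>i<k. path_image (\<gamma> e) \<subseteq> book_page k i"
    if "e \<in> complete_edges n" for e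
    using drawing that unfolding book_drawing_def by blast+
  define V where "V = x ` {..<n}"
  define y where "y = inv_into {..<n} x"
  have y: "y s < n" "x (y s) = s" if "s \<in> V" for s
    using that inv_into_into[of s x "{..<n}"] f_inv_into_f[of s x "{..<n}"] by (auto simp: V_def y_def)
  define edge_on where "edge_on e = {y (fst e), y (snd e)}" for e
  have edge_on: "edge_on e \<in> complete_edges n" and x_edge_on: "x ` edge_on e = {fst e, snd e}"
    if "e \<in> chords V" for e
  proof -
    have "fst e \<in> V" "snd e \<in> V" "fst e \<noteq> snd e" using that by (auto simp: chords_def)
    then have "y (fst e) < n" "y (snd e) < n" "y (fst e) \<noteq> y (snd e)"
      and "x ` edge_on e = {fst e, snd e}"
      using y by (auto simp: edge_on_def) metis
    then show "edge_on e \<in> complete_edges n" "x ` edge_on e = {fst e, snd e}"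
      by (auto simp: complete_edges_def edge_on_def)
  qed
  have edge_on_inj: "e = f" if "e \<in> chords V" "f \<in> chords V" "edge_on e = edge_on f" for e f
  proof -
    have "{fst e, snd e} = {fst f, snd f}" using x_edge_on that by metis
    moreover have "fst e < snd e" "fst f < snd f" using that by (auto simp: chords_def)
    ultimately show ?thesis by (auto simp: doubleton_eq_iff prod_eq_iff)
  qed
  \<comment> \<open>The page need not be unique: an edge drawn along the spine lies in all of
    them.\<close>
  define c where "c e = (SOME i. i < k \<and> path_image (\<gamma> (edge_on e)) \<subseteq> book_page k i)" for e
  have c: "c e < k \<and> path_image (\<gamma> (edge_on e)) \<subseteq> book_page k (c e)" if "e \<in> chords V" for e
    unfolding c_def using edge(4)[OF edge_on[OF that]] by (rule someI_ex)
  let ?X = "edge_crossings {..<n} (complete_edges n) pos \<gamma>"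
  have "\<exists>p. ({edge_on (fst z), edge_on (snd z)}, p) \<in> ?X" if z: "z \<in> monochromatic c V" for z
  proof -
    obtain e f where ef: "z = (e, f)" "e \<in> chords V" "f \<in> chords V" "crosses e f" "c e = c f"
      using z by (auto simp: monochromatic_def crossings_def)
    have ends: "pos ` edge_on g = {(fst g, 0), (snd g, 0)}" if "g \<in> chords V" for g
    proof -
      have "fst g \<in> V" "snd g \<in> V" using that by (auto simp: chords_def)
      then show ?thesis by (simp add: edge_on_def pos y)
    qed
    obtain g where g: "path g" "path_image g = path_image (\<gamma> (edge_on e))"
      "pathstart g = (fst e, 0)" "pathfinish g = (snd e, 0)"
      using oriented_arc[OF edge(1)] edge(2) ends ef edge_on by metis
    obtain h where h: "path h" "path_image h = path_image (\<gamma> (edge_on f))"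
      "pathstart h = (fst f, 0)" "pathfinish h = (snd f, 0)"
      using oriented_arc[OF edge(1)] edge(2) ends ef edge_on by metis
    have ord: "fst e < fst f" "fst f < snd e" "snd e < snd f"
      using ef(4) by (auto simp: crosses_def)
    obtain p where p: "p \<in> path_image g" "p \<in> path_image h"
      using page_paths_meet[OF g(1) h(1) _ _ g(3,4) h(3,4) ord] c[OF ef(2)] c[OF ef(3)] ef(5) g(2) h(2)
      by metis
    \<comment> \<open>An edge contains no vertices but its own ends, and crossing chords have four
      distinct ends.\<close>
    have "p \<notin> pos ` {..<n}"
    proof
      assume "p \<in> pos ` {..<n}"
      then have "p \<in> pos ` edge_on e" "p \<in> pos ` edge_on f"
        using p g(2) h(2) edge(3)[OF edge_on[OF ef(2)]] edge(3)[OF edge_on[OF ef(3)]] by auto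
      then show False using ord by (auto simp: ends ef)
    qed
    moreover have "edge_on e \<noteq> edge_on f"
      using edge_on_inj ef by (metis not_crosses_self)
    ultimately have "({edge_on e, edge_on f}, p) \<in> ?X"
      using p edge_on[OF ef(2)] edge_on[OF ef(3)] unfolding edge_crossings_def g(2) h(2) by blast
    then show ?thesis unfolding ef(1) fst_conv snd_conv by (rule exI)
  qed
  then obtain P where P: "\<And>z. z \<in> monochromatic c V \<Longrightarrow> ({edge_on (fst z), edge_on (snd z)}, P z) \<in> ?X"
    by metis
  have "inj_on (\<lambda>z. ({edge_on (fst z), edge_on (snd z)}, P z)) (monochromatic c V)"
  proof (rule inj_onI)
    fix z w
    assume z: "z \<in> monochromatic c V" and w: "w \<in> monochromatic c V"
      and "({edge_on (fst z), edge_on (snd z)}, P z) = ({edge_on (fst w), edge_on (snd w)}, P w)"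
    then have "edge_on (fst z) = edge_on (fst w) \<and> edge_on (snd z) = edge_on (snd w) \<or>
        edge_on (fst z) = edge_on (snd w) \<and> edge_on (snd z) = edge_on (fst w)"
      by (auto simp: doubleton_eq_iff)
    moreover have "fst z \<in> chords V" "snd z \<in> chords V" "crosses (fst z) (snd z)"
      "fst w \<in> chords V" "snd w \<in> chords V" "crosses (fst w) (snd w)"
      using z w by (auto simp: monochromatic_def crossings_def)
    ultimately show "z = w"
      using edge_on_inj crosses_asym by (metis prod_eq_iff)
  qed
  moreover have "finite ?X"
    by (rule finite_edge_crossings[OF _ drawing]) (simp add: complete_edges_def)
  ultimately have "card (monochromatic c V) \<le> card ?X"
    using P by (intro card_inj_on_le) auto
  moreover have "card V = n" using inj_x by (simp add: V_def card_image)
  ultimately show ?thesis using that[of V c] c by (simp add: V_def)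
qed

theorem theorem2:
  shows "(\<forall>k n :: nat. k \<ge> 3 \<and> int n \<ge> \<lfloor>111 * real k / 20\<rfloor> \<longrightarrow>
            real (book_crossing_number_complete k n) \<ge>
              8000 * (4107 * real k ^ 2 - 5416 * real k + 1309) /
                (37 * (111 * real k - 17) * (111 * real k - 77) * (37 * real k - 19) * (3 * real k - 1))
              * real (n choose 4)) \<and>
         (\<lambda>k :: nat. 8000 * (4107 * real k ^ 2 - 5416 * real k + 1309) /
                (37 * (111 * real k - 17) * (111 * real k - 77) * (37 * real k - 19) * (3 * real k - 1))
              - 8000 / 12321 * (1 / real k ^ 2))
           \<in> \<Theta>(\<lambda>k. 1 / real k ^ 3)"
proof (intro conjI allI impI)
  fix k n :: nat
  assume kn: "k \<ge> 3 \<and> int n \<ge> \<lfloor>111 * real k / 20\<rfloor>"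
  define R where "R = 8000 * (4107 * real k ^ 2 - 5416 * real k + 1309) /
    (37 * (111 * real k - 17) * (111 * real k - 77) * (37 * real k - 19) * (3 * real k - 1))"
  define N where "N = (111 * k) div 20"
  have "\<lfloor>111 * real k / 20\<rfloor> = int N"
    using floor_divide_of_nat_eq[of "111 * k" 20] by (simp add: N_def)
  then have N: "4 \<le> N" "N \<le> n" using kn by (auto simp: N_def)
  \<comment> \<open>The remainder modulo 20 is the \<open>r\<close> of
    \<open>page_count_inequality\<close>.\<close>
  have "111 * k = 20 * N + (111 * k) mod 20" by (simp add: N_def)
  then have N20: "20 * real N = 111 * real k - real ((111 * k) mod 20)"
    by (metis add_diff_cancel_right' of_nat_add of_nat_mult of_nat_numeral)
  have "(111 * k) mod 20 \<le> 19" using pos_mod_bound by (simp add: less_Suc_eq_le[symmetric])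
  then have ineq: "4 * R * (real N * (real N - 1) * (real N - 2) * (real N - 3) / 24)
      \<le> 10 * real N * (real N - 3) - real k * (37 * real N - 102)"
    unfolding R_def using kn by (intro page_count_inequality[OF N20]) auto
  obtain pos \<gamma> where draw: "book_drawing k {..<n} (complete_edges n) pos \<gamma>"
    and num: "book_crossing_number_complete k n = card (edge_crossings {..<n} (complete_edges n) pos \<gamma>)"
    using book_crossing_number_complete_attained[of k n] kn by auto
  obtain V :: "real set" and c where V: "finite V" "card V = n" "\<And>e. e \<in> chords V \<Longrightarrow> c e < k"
    and le: "card (monochromatic c V) \<le> card (edge_crossings {..<n} (complete_edges n) pos \<gamma>)"
    using edge_crossings_ge_monochromatic[OF draw] by blast
  have "R * real (card V choose 4) \<le> real (card (monochromatic c V))"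
  proof (rule monochromatic_ratio)
    fix W assume W: "W \<subseteq> V" "card W = N"
    have "10 * real (card W) * (real (card W) - 3) - real k * (37 * real (card W) - 102)
        \<le> 4 * real (card (monochromatic c W))"
      using W N V kn chords_mono[OF W(1)] by (intro monochromatic_ge) (auto intro: finite_subset)
    then show "R * real (N choose 4) \<le> real (card (monochromatic c W))"
      using ineq[folded real_choose_4[OF N(1)]] unfolding W(2) by linarith
  qed (use N V in auto)
  then show "real (book_crossing_number_complete k n) \<ge>
      8000 * (4107 * real k ^ 2 - 5416 * real k + 1309) /
        (37 * (111 * real k - 17) * (111 * real k - 77) * (37 * real k - 19) * (3 * real k - 1))
      * real (n choose 4)"
    using le V(2) by (simp add: R_def num)
qed real_asymp

end
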